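(* For $n\ge8$ the set $\mathcal{R}_{1,n}$ consists exactly of the permutations of length $n$ of one of the following two forms: - $24153[\iota_a,\iota_1,\iota_c,\iota_d,\iota_e]$ with $a,d\ge1$, $c,e\ge2$ and $(a-1)(c-2)+(d-1)(e-2)=0$; - $31524[\iota_a,\iota_b,\iota_c,\iota_1,\iota_e]$ with $a,c\ge2$, $b,e\ge1$ and $(a-2)(b-1)+(c-2)(e-1)=0$. The two families are exchanged by taking inverse permutations. Consequently $|\mathcal{R}_{1,n}|=8(n-7)$ for $n\ge8$. Moreover $|\mathcal{R}_{1,7}|=2$ and $|\mathcal{R}_{1,n}|=0$ for $n\le6$.
   Context: Permutations are written in one-line notation $\pi=\pi_1\cdots\pi_n$, and $\operatorname{inv}(\pi)$ is the number of pairs $i<j$ with $\pi_i>\pi_j$. A permutation avoids $1324$ if there are no indices $i_1<i_2<i_3<i_4$ with $\pi_{i_1}<\pi_{i_3}<\pi_{i_2}<\pi_{i_4}$. $\mathrm{Av}_n^k(1324)$ is the set of $1324$-avoiding permutations of length $n$ with exactly $k$ inversions. A permutation of length $n$ is decomposable if for some $1\le j<n$ its first $j$ entries are exactly $\{1,\dots,j\}$; otherwise it is indecomposable. $\pi\setminus x$ is obtained by deleting the entry $x$ and standardizing. An indecomposable $\pi$ of length $n$ is almost decomposable if at least one of $\pi\setminus 1$, $\pi\setminus n$, $\pi\setminus\pi_1$, $\pi\setminus\pi_n$ (deleting the smallest, largest, first, last entry) is decomposable. The set of residuals at defect $\delta$ is $$\mathcal{R}_{\delta,n}=\{\pi\in\mathrm{Av}_n^{2n-7+\delta}(1324):\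 \pi\text{ is indecomposable and not almost decomposable}\}.$$ $\iota_m=12\cdots m$ is the increasing permutation of length $m$, and $\tau[\iota_{b_1},\dots,\iota_{b_t}]$ is the inflation of $\tau=\tau_1\cdots\tau_t$ in which the $i$th entry is replaced by an increasing run of $b_i$ entries occupying consecutive positions and consecutive values, the blocks being in the relative order of $\tau$. *)

theory Defs
  imports "HOL-Combinatorics.Combinatorics"
begin

text \<open>
  A permutation of length n in one-line notation is a list in
  \<^term>\<open>permutations_of_set {1..n::nat}\<close>.  List positions are counted from 0,
  entries from 1: the entry written \<pi> with index i is \<^term>\<open>p ! (i - 1)\<close>.
\<close>

type_synonym perm = "nat list"

definition inversions :: "perm \<Rightarrow> nat" where
  "inversions p = card {(i, j). i < j \<and> j < length p \<and> p ! i > p ! j}"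

definition avoids_1324 :: "perm \<Rightarrow> bool" where
  "avoids_1324 p \<longleftrightarrow>
     \<not> (\<exists>i1 i2 i3 i4. i1 < i2 \<and> i2 < i3 \<and> i3 < i4 \<and> i4 < length p \<and>
          p ! i1 < p ! i3 \<and> p ! i3 < p ! i2 \<and> p ! i2 < p ! i4)"

text \<open>The number of inversions is an integer parameter, because it is used with the
  value 2n - 7 + \<delta>, which is negative for small n; the set is then empty.\<close>

definition Av1324 :: "nat \<Rightarrow> int \<Rightarrow> perm set" where
  "Av1324 n k = {p \<in> permutations_of_set {1..n}. avoids_1324 p \<and> int (inversions p) = k}"

definition decomposable :: "perm \<Rightarrow> bool" where
  "decomposable p \<longleftrightarrow> (\<exists>j. 1 \<le> j \<and> j < length p \<and> set (take j p) = {1..j})"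

text \<open>For a list of distinct numbers: each entry is replaced by its rank among the entries.\<close>

definition standardize :: "nat list \<Rightarrow> perm" where
  "standardize xs = map (\<lambda>x. card {y \<in> set xs. y \<le> x}) xs"

definition delete_entry :: "perm \<Rightarrow> nat \<Rightarrow> perm" where
  "delete_entry p x = standardize (removeAll x p)"

definition almost_decomposable :: "perm \<Rightarrow> bool" where
  "almost_decomposable p \<longleftrightarrow> \<not> decomposable p \<and>
     (decomposable (delete_entry p 1) \<or> decomposable (delete_entry p (length p)) \<or>
      decomposable (delete_entry p (hd p)) \<or> decomposable (delete_entry p (last p)))"

definition residuals :: "int \<Rightarrow> nat \<Rightarrow> perm set" where
  "residuals \<delta> n =
     {p \<in> Av1324 n (2 * int n - 7 + \<delta>). \<not> decomposable p \<and> \<not> almost_decomposable p}"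

definition iota :: "nat \<Rightarrow> perm" where
  "iota m = [1..<Suc m]"

text \<open>The block replacing an entry of \<tau> is shifted up by the total length of the blocks
  that replace smaller entries of \<tau>.\<close>

definition inflation :: "perm \<Rightarrow> perm list \<Rightarrow> perm" where
  "inflation \<tau> \<sigma>s =
     concat (map (\<lambda>i. map (\<lambda>x. (\<Sum>j | j < length \<tau> \<and> \<tau> ! j < \<tau> ! i. length (\<sigma>s ! j)) + x) (\<sigma>s ! i))
       [0..<length \<tau>])"

text \<open>The bijection of the natural numbers given by a one-line notation, fixing every number
  outside \<^term>\<open>{1..length p}\<close>.\<close>

definition perm_fun :: "perm \<Rightarrow> nat \<Rightarrow> nat" where
  "perm_fun p i = (if i \<in> {1..length p} then p ! (i - 1) else i)"

definition inverse_perm :: "perm \<Rightarrow> perm" where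
  "inverse_perm p = map (inv (perm_fun p)) [1..<Suc (length p)]"

text \<open>In both families the bounds on the parameters ensure that the truncated subtractions
  on natural numbers are exact.\<close>

definition family_24153 :: "nat \<Rightarrow> perm set" where
  "family_24153 n = {p. length p = n \<and>
     (\<exists>a c d e. a \<ge> 1 \<and> d \<ge> 1 \<and> c \<ge> 2 \<and> e \<ge> 2 \<and> (a - 1) * (c - 2) + (d - 1) * (e - 2) = 0 \<and>
        p = inflation [2, 4, 1, 5, 3] [iota a, iota 1, iota c, iota d, iota e])}"

definition family_31524 :: "nat \<Rightarrow> perm set" where
  "family_31524 n = {p. length p = n \<and>
     (\<exists>a b c e. a \<ge> 2 \<and> c \<ge> 2 \<and> b \<ge> 1 \<and> e \<ge> 1 \<and> (a - 2) * (b - 1) + (c - 2) * (e - 1) = 0 \<and>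
        p = inflation [3, 1, 5, 2, 4] [iota a, iota b, iota c, iota 1, iota e])}"

end

theory Submission
  imports Defs
begin

text \<open>
  A permutation is viewed as a finite set of points \<^term>\<open>V\<close> with a horizontal coordinate (position) and
  a vertical coordinate (entry).  Its inversions are the edges of a graph on \<^term>\<open>V\<close>, and a permutation is
  indecomposable if and only if this graph is connected.  Hence a residual permutation of defect 1 and length \<open>n\<close>
  is a 1324-avoiding one whose graph has \<open>2n - 6\<close> edges and stays connected when any one of the four corners is deleted:
  the leftmost point \<open>f\<close>, the lowest point \<open>b\<close>, the rightmost point \<open>l\<close> and the highest point \<open>t\<close>.
  Avoiding 1324 means that no edge has both a point below and to the left of its two ends and a point
  above and to the right of them.

  The proof counts edges at the corners.  If \<open>f\<close> is higher than \<open>l\<close>, or \<open>t\<close> is left of \<open>b\<close>, there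
  are at least \<open>2n - 5\<close> edges (\<open>first_less_last\<close>).  Otherwise the verticals
  through \<open>b\<close> and \<open>t\<close> and the horizontals through \<open>f\<close> and \<open>l\<close> cut the plane into nine cells.  The central cell
  is empty, because its points would be isolated; a point in one of the four other cells of the middle column
  or middle row is joined to one corner, and a point in one of the four outer cells to two.  Therefore at
  most \<open>p + q + r + s\<close> edges avoid the corners, where \<open>p, q, r, s\<close> are the sizes of the cells \<open>LM, CD, CU, RM\<close>.
  But many edges are forced: \<open>LM\<close> is completely joined to \<open>CD\<close> and \<open>CU\<close> to \<open>RM\<close>, the cell \<open>LU\<close> to \<open>CD\<close> and
  \<open>RM\<close>, and \<open>RD\<close> to \<open>LM\<close> and \<open>CU\<close> (\<open>inner_bound\<close>).
  Connectedness requires \<open>LU\<close> or \<open>RD\<close> to be nonempty, the count forbids both, and exchanging the coordinates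
  exchanges them.  If \<open>RD\<close> is empty, the count forces \<open>LU\<close> to be a single point, \<open>LD\<close> and \<open>RU\<close> to be empty
  and \<open>p(q - 1) + r(s - 1) = 0\<close> (\<open>cell_structure\<close>).  The points \<open>f\<close>, \<open>b\<close>, \<open>t\<close>, \<open>l\<close> with the
  cells \<open>LM\<close>, \<open>CD\<close>, \<open>CU\<close>, \<open>RM\<close> are then increasing blocks of sizes
  \<open>p + 1\<close>, \<open>q + 1\<close>, \<open>r + 1\<close>, \<open>s + 1\<close>, which form an inflation of 24153 together with the point of \<open>LU\<close>.  Conversely, such an inflation is residual, and so is its
  inverse (\<open>inflated_imp_residual_points\<close>).  The argument works for every \<open>n\<close>, so all cardinalities
  follow from counting the parameters (\<open>card_parameter_set\<close>).
\<close>

section \<open>The inversion graph of a point set\<close>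

text \<open>Edges are directed from the upper left end to the lower right end.\<close>

definition inverted :: "('v \<Rightarrow> int) \<Rightarrow> ('v \<Rightarrow> int) \<Rightarrow> 'v \<Rightarrow> 'v \<Rightarrow> bool" where
  "inverted X Y u v \<longleftrightarrow> X u < X v \<and> Y v < Y u"

definition edges :: "('v \<Rightarrow> int) \<Rightarrow> ('v \<Rightarrow> int) \<Rightarrow> 'v set \<Rightarrow> ('v \<times> 'v) set" where
  "edges X Y W = {(u, v). u \<in> W \<and> v \<in> W \<and> inverted X Y u v}"

text \<open>Every partition of \<^term>\<open>W\<close> into two nonempty parts is crossed by an edge.\<close>

definition connected_on :: "('v \<Rightarrow> int) \<Rightarrow> ('v \<Rightarrow> int) \<Rightarrow> 'v set \<Rightarrow> bool" where
  "connected_on X Y W \<longleftrightarrow>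
     (\<forall>S. (\<exists>u\<in>W. u \<in> S) \<and> (\<exists>v\<in>W. v \<notin> S) \<longrightarrow>
        (\<exists>u\<in>W. \<exists>v\<in>W. inverted X Y u v \<and> (u \<in> S) \<noteq> (v \<in> S)))"

text \<open>No four points form the pattern 1324; \<open>s\<close>, \<open>u\<close>, \<open>v\<close>, \<open>g\<close> play the roles of 1, 3, 2, 4.\<close>

definition avoiding :: "('v \<Rightarrow> int) \<Rightarrow> ('v \<Rightarrow> int) \<Rightarrow> 'v set \<Rightarrow> bool" where
  "avoiding X Y V \<longleftrightarrow>
     \<not> (\<exists>s\<in>V. \<exists>u\<in>V. \<exists>v\<in>V. \<exists>g\<in>V. X s < X u \<and> X u < X v \<and> X v < X g \<and>
          Y s < Y v \<and> Y v < Y u \<and> Y u < Y g)"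

text \<open>The smallest, largest, first or last entry.\<close>

definition extreme :: "('v \<Rightarrow> int) \<Rightarrow> ('v \<Rightarrow> int) \<Rightarrow> 'v set \<Rightarrow> 'v \<Rightarrow> bool" where
  "extreme X Y V k \<longleftrightarrow> k \<in> V \<and>
     ((\<forall>v\<in>V. X k \<le> X v) \<or> (\<forall>v\<in>V. X v \<le> X k) \<or> (\<forall>v\<in>V. Y k \<le> Y v) \<or> (\<forall>v\<in>V. Y v \<le> Y k))"

text \<open>The conditions on a residual permutation of defect 1, for a point set.  They are invariant under
  exchanging the coordinates, that is, under taking the inverse permutation.\<close>

definition residual_points :: "('v \<Rightarrow> int) \<Rightarrow> ('v \<Rightarrow> int) \<Rightarrow> 'v set \<Rightarrow> bool" where
  "residual_points X Y V \<longleftrightarrow> avoiding X Y V \<and> int (card (edges X Y V)) = 2 * int (card V) - 6 \<and>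
     connected_on X Y V \<and> (\<forall>k. extreme X Y V k \<longrightarrow> connected_on X Y (V - {k}))"

lemma finite_edges [simp]: "finite W \<Longrightarrow> finite (edges X Y W)"
  by (rule finite_subset[of _ "W \<times> W"]) (auto simp: edges_def)

lemma card_edges_swap: "card (edges Y X W) = card (edges X Y W)"
proof (rule bij_betw_same_card[of prod.swap])
  show "bij_betw prod.swap (edges Y X W) (edges X Y W)"
    by (rule bij_betwI[where g = prod.swap]) (auto simp: edges_def inverted_def)
qed

lemma connected_on_swap: "connected_on Y X W = connected_on X Y W"
proof -
  have "connected_on Y X W" if "connected_on X Y W" for X Y :: "'a \<Rightarrow> int"
    unfolding connected_on_def
  proof (intro allI impI)
    fix S assume "(\<exists>u\<in>W. u \<in> S) \<and> (\<exists>v\<in>W. v \<notin> S)"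
    with that have "\<exists>u\<in>W. \<exists>v\<in>W. inverted X Y u v \<and> (u \<in> S) \<noteq> (v \<in> S)"
      unfolding connected_on_def by simp
    then obtain u v where "v \<in> W" "u \<in> W" "inverted Y X v u" "(v \<in> S) \<noteq> (u \<in> S)"
      by (auto simp: inverted_def)
    thus "\<exists>u\<in>W. \<exists>v\<in>W. inverted Y X u v \<and> (u \<in> S) \<noteq> (v \<in> S)" by blast
  qed
  thus ?thesis by blast
qed

lemma avoiding_swap: "avoiding Y X V = avoiding X Y V"
  unfolding avoiding_def by blast

lemma residual_points_swap: "residual_points Y X V \<longleftrightarrow> residual_points X Y V"
  unfolding residual_points_def extreme_def
  by (auto simp: card_edges_swap connected_on_swap[of Y X] avoiding_swap[of Y X])

lemma connected_on_crossing:
  assumes "connected_on X Y W" "u \<in> W" "u \<in> S" "v \<in> W" "v \<notin> S"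
  shows "\<exists>x y. x \<in> W \<and> y \<in> W \<and> x \<in> S \<and> y \<notin> S \<and> (inverted X Y x y \<or> inverted X Y y x)"
proof -
  have "\<exists>u\<in>W. u \<in> S" "\<exists>v\<in>W. v \<notin> S" using assms(2-5) by blast+
  then obtain x y where "x \<in> W" "y \<in> W" "inverted X Y x y" "(x \<in> S) \<noteq> (y \<in> S)"
    using assms(1)[unfolded connected_on_def, THEN spec, of S] by auto
  thus ?thesis by (cases "x \<in> S") auto
qed

lemma connected_on_neighbour:
  assumes "connected_on X Y W" "u \<in> W" "v \<in> W" "v \<noteq> u"
  shows "\<exists>y\<in>W. y \<noteq> u \<and> (inverted X Y u y \<or> inverted X Y y u)"
  using connected_on_crossing[OF assms(1,2), of "{u}" v] assms by auto

text \<open>The edge bound of a spanning tree, proved by growing a set of vertices one crossing edge at a time.\<close>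

lemma connected_on_card_edges:
  assumes "finite W" "connected_on X Y W"
  shows "card W \<le> Suc (card (edges X Y W))"
proof (cases "W = {}")
  case False
  have "\<exists>S\<subseteq>W. card S = Suc k \<and> k \<le> card (edges X Y S)" if "Suc k \<le> card W" for k
    using that
  proof (induction k)
    case 0
    from False obtain x where "x \<in> W" by blast
    thus ?case by (intro exI[of _ "{x}"]) auto
  next
    case (Suc k)
    then obtain S where S: "S \<subseteq> W" "card S = Suc k" "k \<le> card (edges X Y S)" by auto
    have "finite S" using S assms(1) finite_subset by blast
    obtain x0 where x0: "x0 \<in> S" using S by fastforce
    have "S \<noteq> W" using S Suc.prems by auto
    then obtain y0 where y0: "y0 \<in> W" "y0 \<notin> S" using S(1) by blast
    obtain x y where xy: "x \<in> S" "y \<in> W" "y \<notin> S" "inverted X Y x y \<or> inverted X Y y x"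
      using connected_on_crossing[OF assms(2), of x0 S y0] x0 y0 S(1) by auto
    define z where "z = (if inverted X Y x y then (x, y) else (y, x))"
    have "insert z (edges X Y S) \<subseteq> edges X Y (insert y S)" "z \<notin> edges X Y S"
      using xy by (auto simp: z_def edges_def)
    hence "Suc (card (edges X Y S)) \<le> card (edges X Y (insert y S))"
      using \<open>finite S\<close> by (metis card_insert_disjoint card_mono finite_edges finite_insert)
    thus ?case using xy S \<open>finite S\<close> by (intro exI[of _ "insert y S"]) auto
  qed
  from this[of "card W - 1"] obtain S where S: "S \<subseteq> W" "card S = card W" "card W - 1 \<le> card (edges X Y S)"
    using False assms(1) by (metis One_nat_def Suc_pred card_gt_0_iff order_refl)
  hence "S = W" using assms(1) card_subset_eq by blast
  thus ?thesis using S by simp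
qed simp

text \<open>Vertices each having a neighbour outside their set \<^term>\<open>Z\<close> account for as many different edges.\<close>

lemma card_le_edges_leaving:
  assumes "finite W" "Z \<subseteq> W" "\<And>z. z \<in> Z \<Longrightarrow> \<exists>y\<in>N. inverted X Y z y \<or> inverted X Y y z"
    "N \<subseteq> W" "N \<inter> Z = {}"
  shows "card Z \<le> card {(u, v) \<in> edges X Y W. u \<in> Z \<and> v \<in> N \<or> u \<in> N \<and> v \<in> Z}" (is "_ \<le> card ?E")
proof -
  obtain g where g: "\<And>z. z \<in> Z \<Longrightarrow> g z \<in> N \<and> (inverted X Y z (g z) \<or> inverted X Y (g z) z)"
    using assms(3) by metis
  define h where "h z = (if inverted X Y z (g z) then (z, g z) else (g z, z))" for z
  have inj: "inj_on h Z" using g assms(5) by (auto simp: inj_on_def h_def split: if_splits)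
  have sub: "h ` Z \<subseteq> ?E" using g assms(2,4) by (auto simp: h_def edges_def)
  have "finite ?E" using finite_edges[OF assms(1), of X Y] by (rule rev_finite_subset) auto
  from card_mono[OF this sub] show ?thesis by (simp add: card_image[OF inj])
qed

section \<open>Permutations as point sets\<close>

text \<open>Standardization drops out: decomposability says that some proper prefix lies below the rest.\<close>

lemma decomposable_standardize_iff:
  assumes "distinct xs"
  shows "decomposable (standardize xs) \<longleftrightarrow>
    (\<exists>j. 1 \<le> j \<and> j < length xs \<and> (\<forall>x\<in>set (take j xs). \<forall>y\<in>set (drop j xs). x < y))"
proof -
  define rank where "rank x = card {y \<in> set xs. y \<le> x}" for x
  have mono: "rank x < rank y" if "x < y" "y \<in> set xs" for x y
  proof -
    have "y \<notin> {z \<in> set xs. z \<le> x}" "y \<in> {z \<in> set xs. z \<le> y}" using that by auto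
    moreover have "{z \<in> set xs. z \<le> x} \<subseteq> {z \<in> set xs. z \<le> y}" using that(1) by auto
    ultimately have "{z \<in> set xs. z \<le> x} \<subset> {z \<in> set xs. z \<le> y}" by blast
    thus ?thesis unfolding rank_def by (intro psubset_card_mono) auto
  qed
  have pos: "1 \<le> rank x" if "x \<in> set xs" for x
  proof -
    have "card {x} \<le> rank x" unfolding rank_def using that by (intro card_mono) auto
    thus ?thesis by simp
  qed
  have inj: "inj_on rank (set xs)"
    using mono by (auto simp: inj_on_def) (metis less_irrefl linorder_neqE_nat)
  have tk: "set (take j (standardize xs)) = rank ` set (take j xs)" for j
    by (simp add: standardize_def rank_def take_map)
  have "set (take j (standardize xs)) = {1..j} \<longleftrightarrow>
      (\<forall>x\<in>set (take j xs). \<forall>y\<in>set (drop j xs). x < y)" if j: "j < length xs" for j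
  proof
    assume L: "set (take j (standardize xs)) = {1..j}"
    show "\<forall>x\<in>set (take j xs). \<forall>y\<in>set (drop j xs). x < y"
    proof (intro ballI)
      fix x y assume x: "x \<in> set (take j xs)" and y: "y \<in> set (drop j xs)"
      have xy: "x \<in> set xs" "y \<in> set xs" using x y by (meson in_set_takeD in_set_dropD)+
      have "y \<notin> set (take j xs)" using y assms
        by (metis set_take_disj_set_drop_if_distinct disjoint_iff order_refl)
      hence "rank y \<notin> {1..j}"
        unfolding L[symmetric] tk using inj xy by (auto simp: inj_on_def dest: in_set_takeD)
      moreover have "rank x \<in> {1..j}" using x L tk by blast
      ultimately have "rank x < rank y" using pos[OF xy(2)] by auto
      thus "x < y" using mono xy by (metis less_asym linorder_neqE_nat)
    qed
  next
    assume R: "\<forall>x\<in>set (take j xs). \<forall>y\<in>set (drop j xs). x < y"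
    have card: "card (set (take j xs)) = j"
      using assms j by (simp add: distinct_card)
    have "rank x \<le> j" if x: "x \<in> set (take j xs)" for x
    proof -
      have "set xs = set (take j xs) \<union> set (drop j xs)" by (metis append_take_drop_id set_append)
      hence "{y \<in> set xs. y \<le> x} \<subseteq> set (take j xs)" using R x by force
      thus ?thesis unfolding rank_def using card card_mono by (metis List.finite_set)
    qed
    hence "rank ` set (take j xs) \<subseteq> {1..j}" using pos in_set_takeD by fastforce
    moreover have "card (rank ` set (take j xs)) = j"
      using card inj by (metis card_image inj_on_subset set_take_subset)
    ultimately show "set (take j (standardize xs)) = {1..j}"
      unfolding tk by (intro card_subset_eq) auto
  qed
  thus ?thesis unfolding decomposable_def by (auto simp: standardize_def)
qed

text \<open>The list \<^term>\<open>ks\<close> of positions is arbitrary so that the lemma also applies after a deletion.\<close>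

lemma decomposable_iff_not_connected:
  fixes g :: "nat \<Rightarrow> nat"
  assumes sorted: "sorted_wrt (<) ks" and inj: "inj_on g (set ks)"
  shows "decomposable (standardize (map g ks)) \<longleftrightarrow> \<not> connected_on int (\<lambda>i. int (g i)) (set ks)"
proof -
  have dist: "distinct ks" using sorted by (simp add: strict_sorted_iff)
  have iff: "decomposable (standardize (map g ks)) \<longleftrightarrow>
    (\<exists>j. 1 \<le> j \<and> j < length ks \<and> (\<forall>x\<in>set (take j ks). \<forall>y\<in>set (drop j ks). g x < g y))"
    using decomposable_standardize_iff[of "map g ks"] dist inj
    by (simp add: distinct_map take_map drop_map)
  have before: "x < y" if "x \<in> set (take j ks)" "y \<in> set (drop j ks)" for x y j
    using sorted that by (metis append_take_drop_id sorted_wrt_append)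
  have un: "set ks = set (take j ks) \<union> set (drop j ks)" for j by (metis append_take_drop_id set_append)
  show ?thesis
  proof
    assume "decomposable (standardize (map g ks))"
    then obtain j where j: "1 \<le> j" "j < length ks"
      "\<forall>x\<in>set (take j ks). \<forall>y\<in>set (drop j ks). g x < g y" using iff by blast
    define S where "S = set (take j ks)"
    have disj: "S \<inter> set (drop j ks) = {}" using before[of _ j] unfolding S_def by blast
    have "take j ks \<noteq> []" "drop j ks \<noteq> []" using j by auto
    then obtain u v where "u \<in> S" "v \<in> set (drop j ks)" unfolding S_def by (metis list.set_intros(1) neq_Nil_conv)
    hence uv: "u \<in> set ks" "u \<in> S" "v \<in> set ks" "v \<notin> S" using disj un[of j] unfolding S_def by auto
    show "\<not> connected_on int (\<lambda>i. int (g i)) (set ks)"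
    proof
      assume "connected_on int (\<lambda>i. int (g i)) (set ks)"
      then obtain x y where "x \<in> S" "y \<in> set ks" "y \<notin> S"
        "inverted int (\<lambda>i. int (g i)) x y \<or> inverted int (\<lambda>i. int (g i)) y x"
        using connected_on_crossing[OF _ uv, of int "\<lambda>i. int (g i)"] by blast
      moreover from this have "y \<in> set (drop j ks)" using un[of j] S_def by blast
      ultimately show False using j(3) before[of x j y] unfolding S_def inverted_def by force
    qed
  next
    assume "\<not> connected_on int (\<lambda>i. int (g i)) (set ks)"
    then obtain S where S: "\<exists>u\<in>set ks. u \<in> S" "\<exists>v\<in>set ks. v \<notin> S"
      and nc: "\<And>u v. u \<in> set ks \<Longrightarrow> v \<in> set ks \<Longrightarrow> u < v \<Longrightarrow> g v < g u \<Longrightarrow> (u \<in> S) = (v \<in> S)"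
      unfolding connected_on_def inverted_def of_nat_less_iff by blast
    have "ks \<noteq> []" using S by auto
    (* the longest prefix that lies on the same side of the partition as the first position *)
    define P where "P x \<longleftrightarrow> (x \<in> S) = (hd ks \<in> S)" for x
    define j where "j = length (takeWhile P ks)"
    have tk: "take j ks = takeWhile P ks" unfolding j_def by (metis takeWhile_eq_take)
    have dr: "drop j ks = dropWhile P ks" unfolding j_def by (metis dropWhile_eq_drop)
    have j1: "1 \<le> j" using \<open>ks \<noteq> []\<close> unfolding j_def by (cases ks) (auto simp: P_def)
    have ne: "dropWhile P ks \<noteq> []" using S by (auto simp: dropWhile_eq_Nil_conv P_def)
    hence j2: "j < length ks" using dr by (metis drop_all not_le_imp_less)
    define y where "y = hd (dropWhile P ks)"
    have y: "\<not> P y" "y \<in> set (drop j ks)" using hd_dropWhile[OF ne] list.set_sel(1)[OF ne] unfolding y_def dr by auto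
    have "g x < g z" if x: "x \<in> set (take j ks)" and z: "z \<in> set (drop j ks)" for x z
    proof -
      have Px: "P x" using x unfolding tk by (metis set_takeWhileD)
      have in_ks: "x \<in> set ks" "z \<in> set ks" "y \<in> set ks" using x z y un[of j] by auto
      have xz: "x < z" using before x z by blast
      have less: "g x < g v" if "\<not> P v" "v \<in> set (drop j ks)" for v
      proof -
        have "x < v" "v \<in> set ks" using before x that un[of j] by auto
        hence "\<not> g v < g x" using nc[of x v] in_ks Px that unfolding P_def by blast
        moreover have "g v \<noteq> g x" using inj in_ks \<open>v \<in> set ks\<close> \<open>x < v\<close> by (metis inj_onD less_irrefl)
        ultimately show ?thesis by simp
      qed
      show ?thesis
      proof (cases "P z")
        case True
        hence "z \<noteq> y" using y by auto
        have "drop j ks = y # tl (drop j ks)" using ne unfolding dr y_def by simp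
        moreover have "sorted_wrt (<) (drop j ks)" using sorted by (simp add: sorted_wrt_drop)
        ultimately have "y < z" using z \<open>z \<noteq> y\<close> by (metis set_ConsD sorted_wrt.simps(2))
        hence "\<not> g z < g y" using nc[of y z] in_ks True y unfolding P_def by blast
        thus ?thesis using less[OF y] by simp
      qed (use less z in blast)
    qed
    thus "decomposable (standardize (map g ks))" using iff j1 j2 by blast
  qed
qed

lemma standardize_permutation:
  assumes "p \<in> permutations_of_set {1..n}"
  shows "standardize p = p"
proof -
  have "card {y \<in> set p. y \<le> x} = x" if "x \<in> set p" for x
  proof -
    have "{y \<in> set p. y \<le> x} = {1..x}" using assms that by (auto simp: permutations_of_set_def)
    thus ?thesis by simp
  qed
  thus ?thesis unfolding standardize_def by (simp add: map_idI)
qed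

lemma permutation_facts:
  assumes "p \<in> permutations_of_set {1..n}"
  shows "length p = n" "distinct p" "set p = {1..n}" "inj_on ((!) p) {..<n}"
    "\<And>i. i < n \<Longrightarrow> 1 \<le> p ! i \<and> p ! i \<le> n"
proof -
  show d: "distinct p" "set p = {1..n}" using assms by (auto simp: permutations_of_set_def)
  show l: "length p = n" using d distinct_card by fastforce
  show "inj_on ((!) p) {..<n}" using d l by (auto simp: inj_on_def nth_eq_iff_index_eq)
  show "1 \<le> p ! i \<and> p ! i \<le> n" if "i < n" for i
    using d l that nth_mem by force
qed

lemma decomposable_permutation_iff:
  assumes "p \<in> permutations_of_set {1..n}"
  shows "decomposable p \<longleftrightarrow> \<not> connected_on int (\<lambda>i. int (p ! i)) {..<n}"
proof -
  note P = permutation_facts[OF assms]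
  have "map ((!) p) [0..<n] = p" using P(1) by (metis map_nth)
  thus ?thesis
    using decomposable_iff_not_connected[of "[0..<n]" "(!) p"] P(4) standardize_permutation[OF assms]
    by (simp add: lessThan_atLeast0)
qed

lemma decomposable_delete_iff:
  assumes "p \<in> permutations_of_set {1..n}" "k < n"
  shows "decomposable (delete_entry p (p ! k)) \<longleftrightarrow>
    \<not> connected_on int (\<lambda>i. int (p ! i)) ({..<n} - {k})"
proof -
  note P = permutation_facts[OF assms(1)]
  define ks where "ks = filter (\<lambda>i. i \<noteq> k) [0..<n]"
  have ks: "set ks = {..<n} - {k}" "sorted_wrt (<) ks"
    unfolding ks_def by (auto simp: sorted_wrt_filter)
  have m: "map ((!) p) [0..<n] = p" using P(1) by (metis map_nth)
  have "removeAll (p ! k) p = filter (\<lambda>x. x \<noteq> p ! k) p"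
    unfolding removeAll_filter_not_eq by (intro filter_cong) auto
  also have "\<dots> = filter (\<lambda>x. x \<noteq> p ! k) (map ((!) p) [0..<n])" by (simp only: m)
  also have "\<dots> = map ((!) p) (filter (\<lambda>i. p ! i \<noteq> p ! k) [0..<n])"
    by (simp add: filter_map o_def)
  also have "filter (\<lambda>i. p ! i \<noteq> p ! k) [0..<n] = ks"
    unfolding ks_def using P assms(2) by (intro filter_cong) (auto simp: nth_eq_iff_index_eq)
  finally have "removeAll (p ! k) p = map ((!) p) ks" .
  thus ?thesis unfolding delete_entry_def
    using decomposable_iff_not_connected[OF ks(2), of "(!) p"] P(4) ks(1)
    by (metis inj_on_subset Diff_subset)
qed

lemma residuals_iff:
  assumes p: "p \<in> permutations_of_set {1..n}"
  shows "p \<in> residuals 1 n \<longleftrightarrow> residual_points int (\<lambda>i. int (p ! i)) {..<n}"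
proof (cases "n = 0")
  case True
  thus ?thesis using p
    by (auto simp: residuals_def Av1324_def residual_points_def)
next
  case False
  note P = permutation_facts[OF p]
  let ?Y = "\<lambda>i. int (p ! i)"
  have av: "avoids_1324 p \<longleftrightarrow> avoiding int ?Y {..<n}"
  proof -
    have "(\<exists>i1 i2 i3 i4. i1 < i2 \<and> i2 < i3 \<and> i3 < i4 \<and> i4 < n \<and> p ! i1 < p ! i3 \<and> p ! i3 < p ! i2 \<and> p ! i2 < p ! i4)
      \<longleftrightarrow> (\<exists>s\<in>{..<n}. \<exists>u\<in>{..<n}. \<exists>v\<in>{..<n}. \<exists>g\<in>{..<n}. s < u \<and> u < v \<and> v < g \<and>
          p ! s < p ! v \<and> p ! v < p ! u \<and> p ! u < p ! g)" (is "?l \<longleftrightarrow> ?r")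
    proof
      assume ?l
      then obtain i1 i2 i3 i4 where i: "i1 < i2" "i2 < i3" "i3 < i4" "i4 < n"
        and *: "p ! i1 < p ! i3 \<and> p ! i3 < p ! i2 \<and> p ! i2 < p ! i4" by blast
      from i have "i1 \<in> {..<n}" "i2 \<in> {..<n}" "i3 \<in> {..<n}" "i4 \<in> {..<n}" by auto
      with i * show ?r by blast
    qed (meson lessThan_iff)
    thus ?thesis unfolding avoids_1324_def avoiding_def P(1) by simp
  qed
  have "{(i, j). i < j \<and> j < length p \<and> p ! i > p ! j} = edges int ?Y {..<n}"
    using P(1) by (auto simp: edges_def inverted_def)
  hence inv: "inversions p = card (edges int ?Y {..<n})" by (simp add: inversions_def)
  obtain b where b: "b < n" "p ! b = 1" using P(1,3) False
    by (metis One_nat_def Suc_leI atLeastAtMost_iff in_set_conv_nth neq0_conv order_refl)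
  obtain t where t: "t < n" "p ! t = n" using P(1,3) False
    by (metis One_nat_def Suc_leI atLeastAtMost_iff in_set_conv_nth neq0_conv order_refl)
  have "p \<noteq> []" using P(1) False by auto
  hence hd: "hd p = p ! 0" and last: "last p = p ! (n - 1)"
    using P(1) by (auto simp: hd_conv_nth last_conv_nth)
  have ext: "extreme int ?Y {..<n} k \<longleftrightarrow> k = 0 \<or> k = n - 1 \<or> k = b \<or> k = t" for k
  proof
    assume "extreme int ?Y {..<n} k"
    hence k: "k < n" and c: "(\<forall>v<n. k \<le> v) \<or> (\<forall>v<n. v \<le> k) \<or> (\<forall>v<n. p ! k \<le> p ! v) \<or> (\<forall>v<n. p ! v \<le> p ! k)"
      by (auto simp: extreme_def)
    from c consider "k \<le> 0" | "n - 1 \<le> k" | "p ! k \<le> p ! b" | "p ! t \<le> p ! k" using b t False by force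
    thus "k = 0 \<or> k = n - 1 \<or> k = b \<or> k = t"
    proof cases
      case 3 hence "p ! k = p ! b" using b P(5)[OF k] by simp
      hence "k = b" using inj_onD[OF P(4)] k b by blast
      thus ?thesis by blast
    next
      case 4 hence "p ! k = p ! t" using t P(5)[OF k] by simp
      hence "k = t" using inj_onD[OF P(4)] k t by blast
      thus ?thesis by blast
    qed (use k in auto)
  next
    assume "k = 0 \<or> k = n - 1 \<or> k = b \<or> k = t"
    thus "extreme int ?Y {..<n} k" using False b t P(5) by (auto simp: extreme_def)
  qed
  have "(\<forall>k. extreme int ?Y {..<n} k \<longrightarrow> connected_on int ?Y ({..<n} - {k})) \<longleftrightarrow>
      \<not> (decomposable (delete_entry p 1) \<or> decomposable (delete_entry p (length p)) \<or>
      decomposable (delete_entry p (hd p)) \<or> decomposable (delete_entry p (last p)))"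
    unfolding ext
    using decomposable_delete_iff[OF p, of b] decomposable_delete_iff[OF p, of t]
      decomposable_delete_iff[OF p, of 0] decomposable_delete_iff[OF p, of "n - 1"] b t False P(1) hd last
    by auto
  thus ?thesis using p av inv decomposable_permutation_iff[OF p]
    by (auto simp: residuals_def Av1324_def almost_decomposable_def residual_points_def)
qed

section \<open>Residual point sets are inflations\<close>

text \<open>Position or entry counted from 0, recovered from an arbitrary integer coordinate.\<close>

definition rank :: "('v \<Rightarrow> int) \<Rightarrow> 'v set \<Rightarrow> 'v \<Rightarrow> nat" where
  "rank X V v = card {u \<in> V. X u < X v}"

text \<open>The inflation of 24153 with increasing blocks of sizes \<open>a\<close>, \<open>1\<close>, \<open>c\<close>, \<open>d\<close>, \<open>e\<close> as a function from
  positions to entries, both counted from 0.\<close>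

definition phi :: "nat \<Rightarrow> nat \<Rightarrow> nat \<Rightarrow> nat \<Rightarrow> nat \<Rightarrow> nat" where
  "phi a c d e i =
     (if i < a then c + i else if i = a then a + c + e else if i \<le> a + c then i - (a + 1)
      else if i \<le> a + c + d then i + e else i - (d + 1))"

text \<open>The admissible block sizes for length \<open>n\<close>.  The same sizes describe the second family, with the
  blocks permuted as in \<open>psi\<close> below.\<close>

definition parameters :: "nat \<Rightarrow> nat \<Rightarrow> nat \<Rightarrow> nat \<Rightarrow> nat \<Rightarrow> bool" where
  "parameters n a c d e \<longleftrightarrow> 1 \<le> a \<and> 1 \<le> d \<and> 2 \<le> c \<and> 2 \<le> e \<and>
     (a - 1) * (c - 2) + (d - 1) * (e - 2) = 0 \<and> n = a + 1 + c + d + e"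

text \<open>The point set is order isomorphic to a member of the first family.\<close>

definition inflated_24153 :: "('v \<Rightarrow> int) \<Rightarrow> ('v \<Rightarrow> int) \<Rightarrow> 'v set \<Rightarrow> bool" where
  "inflated_24153 X Y V \<longleftrightarrow> (\<exists>a c d e. parameters (card V) a c d e \<and>
     (\<forall>v\<in>V. rank Y V v = phi a c d e (rank X V v)))"

lemma card_Un_eq:
  assumes "finite A" "finite B" "A \<inter> B = {}" "card A = m" "card B = k"
  shows "card (A \<union> B) = m + k"
  using assms card_Un_disjoint by blast

text \<open>For an increasing block \<^term>\<open>B\<close>, the points to its left form \<^term>\<open>P\<close> and the points below it form \<^term>\<open>Q\<close>.
  Within the block both ranks increase together.\<close>

lemma rank_in_block:
  assumes "finite V" "V = P \<union> B \<union> P'" "V = Q \<union> B \<union> Q'" "v \<in> B"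
    and "\<And>u. u \<in> P \<Longrightarrow> u \<notin> B" "\<And>u. u \<in> Q \<Longrightarrow> u \<notin> B"
    and "\<And>u w. u \<in> P \<Longrightarrow> w \<in> B \<Longrightarrow> X u < X w" "\<And>u w. u \<in> P' \<Longrightarrow> w \<in> B \<Longrightarrow> X w < X u"
    and "\<And>u w. u \<in> Q \<Longrightarrow> w \<in> B \<Longrightarrow> Y u < Y w" "\<And>u w. u \<in> Q' \<Longrightarrow> w \<in> B \<Longrightarrow> Y w < Y u"
    and "\<And>u w. u \<in> B \<Longrightarrow> w \<in> B \<Longrightarrow> X u < X w \<longleftrightarrow> Y u < Y w"
  shows "\<exists>r < card B. rank X V v = card P + r \<and> rank Y V v = card Q + r"
proof (intro exI conjI)
  let ?B = "{u \<in> B. X u < X v}"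
  have fin: "finite P" "finite Q" "finite B" using assms(1-3) by (metis finite_Un)+
  show "card ?B < card B"
    using fin(3) assms(4) by (intro psubset_card_mono) auto
  have "{u \<in> V. X u < X v} = P \<union> ?B" using assms(2,4,7,8) by fastforce
  moreover have "P \<inter> ?B = {}" using assms(5) by auto
  ultimately show "rank X V v = card P + card ?B"
    unfolding rank_def using fin by (simp add: card_Un_disjoint)
  have "{u \<in> V. Y u < Y v} = Q \<union> ?B" using assms(3,4,9,10,11) by fastforce
  moreover have "Q \<inter> ?B = {}" using assms(6) by auto
  ultimately show "rank Y V v = card Q + card ?B"
    unfolding rank_def using fin by (simp add: card_Un_disjoint)
qed

text \<open>The reflection in the antidiagonal maps each edge to itself.\<close>

lemma residual_points_reflect:
  assumes "residual_points X Y V"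
  shows "residual_points (\<lambda>v. - Y v) (\<lambda>v. - X v) V"
proof -
  have i: "inverted (\<lambda>v. - Y v) (\<lambda>v. - X v) = inverted X Y"
    by (auto simp: inverted_def fun_eq_iff)
  have e: "edges (\<lambda>v. - Y v) (\<lambda>v. - X v) V = edges X Y V" by (simp add: edges_def i)
  have c: "connected_on (\<lambda>v. - Y v) (\<lambda>v. - X v) W = connected_on X Y W" for W
    by (simp add: connected_on_def i)
  have x: "extreme (\<lambda>v. - Y v) (\<lambda>v. - X v) V k \<Longrightarrow> extreme X Y V k" for k
    by (auto simp: extreme_def)
  have a: "avoiding (\<lambda>v. - Y v) (\<lambda>v. - X v) V"
    using assms unfolding residual_points_def avoiding_def neg_less_iff_less by blast
  show ?thesis using assms a x unfolding residual_points_def e c by blast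
qed

text \<open>Applied with the cell sizes \<open>p = LM\<close>, \<open>q = CD\<close>, \<open>u = LU\<close> and the number \<open>m\<close> of inner edges
  at \<open>LD\<close>.  The right-hand side is at least \<open>p + q\<close>, and larger if \<open>q = 0\<close>, when only \<open>m\<close> is left of it.\<close>

lemma edge_count_arithmetic:
  fixes p q u m :: nat
  assumes "1 \<le> u" "q = 0 \<longrightarrow> Suc p \<le> m"
  shows "p + q + (if q = 0 then 1 else p * (q - 1) + (u - 1) * q + m) \<le> p * q + u * q + m"
proof (cases q)
  case (Suc k)
  obtain j where "u = Suc j" using assms(1) by (cases u) auto
  thus ?thesis using Suc by (simp add: algebra_simps)
qed (use assms in auto)

text \<open>A residual point set with its leftmost, lowest, rightmost and highest point.  The locale is closed
  under two symmetries of the plane, \<open>swap\<close> and \<open>reflect\<close>, which permute the corners.\<close>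

locale residual_corners =
  fixes X Y :: "'v \<Rightarrow> int" and V :: "'v set" and f b l t :: 'v
  assumes finite_V: "finite V" and inj_X: "inj_on X V" and inj_Y: "inj_on Y V"
    and corners: "f \<in> V" "b \<in> V" "l \<in> V" "t \<in> V"
    and leftmost: "v \<in> V \<Longrightarrow> X f \<le> X v" and bottom: "v \<in> V \<Longrightarrow> Y b \<le> Y v"
    and rightmost: "v \<in> V \<Longrightarrow> X v \<le> X l" and top: "v \<in> V \<Longrightarrow> Y v \<le> Y t"
    and residual: "residual_points X Y V"
begin

lemma swap: "residual_corners Y X V b f t l"
  using finite_V inj_X inj_Y corners leftmost bottom rightmost top residual
  by unfold_locales (auto simp: residual_points_swap[of Y X])

lemma reflect: "residual_corners (\<lambda>v. - Y v) (\<lambda>v. - X v) V t l b f"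
  using finite_V inj_X inj_Y corners leftmost bottom rightmost top residual_points_reflect[OF residual]
  by unfold_locales (auto simp: inj_on_def)

abbreviation inverted' (infix "\<searrow>" 50) where "u \<searrow> v \<equiv> inverted X Y u v"

lemma connected: "connected_on X Y V"
  and connected_minus: "k \<in> {f, b, l, t} \<Longrightarrow> connected_on X Y (V - {k})"
  using residual corners leftmost bottom rightmost top
  unfolding residual_points_def extreme_def by auto

lemma count: "int (card (edges X Y V)) = 2 * int (card V) - 6"
  using residual unfolding residual_points_def by blast

lemma card_V: "3 \<le> card V" using count by simp

lemma avoid:
  assumes "u \<searrow> v" "s \<in> V" "u \<in> V" "v \<in> V" "g \<in> V" "X s < X u" "Y s < Y v" "X v < X g" "Y u < Y g"
  shows False
proof -
  have "X u < X v" "Y v < Y u" using assms(1) by (auto simp: inverted_def)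
  thus False using assms(2-) residual unfolding residual_points_def avoiding_def by blast
qed

lemma neq_X: "u \<in> V \<Longrightarrow> v \<in> V \<Longrightarrow> u \<noteq> v \<Longrightarrow> X u \<noteq> X v"
  using inj_X by (auto simp: inj_on_def)

lemma neq_Y: "u \<in> V \<Longrightarrow> v \<in> V \<Longrightarrow> u \<noteq> v \<Longrightarrow> Y u \<noteq> Y v"
  using inj_Y by (auto simp: inj_on_def)

lemma strict:
  assumes "v \<in> V"
  shows "v \<noteq> f \<Longrightarrow> X f < X v" "v \<noteq> b \<Longrightarrow> Y b < Y v" "v \<noteq> l \<Longrightarrow> X v < X l" "v \<noteq> t \<Longrightarrow> Y v < Y t"
  using neq_X neq_Y corners leftmost[OF assms] bottom[OF assms] rightmost[OF assms] top[OF assms] assms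
  by (metis order_le_less)+

lemma neighbour:
  assumes "u \<in> V" "k \<in> {f, b, l, t}" "u \<noteq> k"
  shows "\<exists>y\<in>V. y \<noteq> k \<and> (u \<searrow> y \<or> y \<searrow> u)"
proof -
  have "card {u, k} \<le> 2" by (simp add: card_insert_if)
  hence "\<not> V \<subseteq> {u, k}" using card_V card_mono[of "{u, k}" V] by auto
  then obtain v where "v \<in> V" "v \<noteq> u" "v \<noteq> k" by blast
  thus ?thesis
    using connected_on_neighbour[OF connected_minus[OF assms(2)], of u v] assms by auto
qed

lemma f_neq_b: "f \<noteq> b"
proof
  assume fb: "f = b"
  have "\<not> V \<subseteq> {f}" using card_V card_mono[of "{f}" V] by auto
  then obtain v where "v \<in> V" "v \<noteq> f" by blast
  then obtain y where "y \<in> V" "f \<searrow> y \<or> y \<searrow> f"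
    using connected_on_neighbour[OF connected, of f v] corners by blast
  thus False using leftmost[of y] bottom[of y] fb by (auto simp: inverted_def)
qed

lemma f_neq_l: "f \<noteq> l"
proof
  assume fl: "f = l"
  have "\<not> V \<subseteq> {f}" using card_V card_mono[of "{f}" V] by auto
  then obtain v where "v \<in> V" "v \<noteq> f" by blast
  thus False using strict(1)[of v] rightmost[of v] fl by auto
qed

text \<open>An entry that is both leftmost and largest has the maximal degree; together with the edges
  that keep the rest connected, these are too many edges.\<close>

lemma f_neq_t: "f \<noteq> t"
proof
  assume ft: "f = t"
  let ?W = "V - {f}"
  have W: "card ?W = card V - 1" "finite ?W" using corners finite_V by auto
  have "Pair f ` ?W \<union> edges X Y ?W \<subseteq> edges X Y V"
    using corners strict(1,4) ft by (auto simp: edges_def inverted_def)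
  moreover have "Pair f ` ?W \<inter> edges X Y ?W = {}" by (auto simp: edges_def)
  ultimately have "card (Pair f ` ?W) + card (edges X Y ?W) \<le> card (edges X Y V)"
    using W(2) finite_V by (metis card_Un_disjoint card_mono finite_edges finite_imageI)
  moreover have "card (Pair f ` ?W) = card ?W" by (simp add: card_image inj_on_def)
  moreover have "card ?W \<le> Suc (card (edges X Y ?W))"
    using connected_on_card_edges[OF W(2)] connected_minus by blast
  ultimately show False using count card_V W(1) by linarith
qed

lemma corners_distinct: "f \<noteq> b" "f \<noteq> l" "f \<noteq> t" "b \<noteq> l" "b \<noteq> t" "l \<noteq> t"
proof -
  interpret S: residual_corners Y X V b f t l by (rule swap)
  interpret R: residual_corners "\<lambda>v. - Y v" "\<lambda>v. - X v" V t l b f by (rule reflect)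
  show "f \<noteq> b" "f \<noteq> l" "f \<noteq> t" "b \<noteq> l" "b \<noteq> t" "l \<noteq> t"
    using f_neq_b f_neq_l f_neq_t S.f_neq_t S.f_neq_l R.f_neq_b by auto
qed

text \<open>The points other than the corners.\<close>

definition I :: "'v set" where "I = V - {f, b, l, t}"

lemma finite_I [simp]: "finite I" using finite_V by (simp add: I_def)

lemma card_I: "card V = card I + 4"
proof -
  have "card {f, b, l, t} = 4" using corners_distinct by simp
  moreover have "{f, b, l, t} \<subseteq> V" using corners by auto
  ultimately show ?thesis unfolding I_def
    using card_Diff_subset[of "{f, b, l, t}" V] card_mono[OF finite_V, of "{f, b, l, t}"] by simp
qed

text \<open>Counts the edges inside \<^term>\<open>I\<close>, the edges from \<^term>\<open>I\<close> to each corner, and a given set of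
  edges between corners.\<close>

lemma corner_bound:
  assumes "K \<subseteq> edges X Y {f, b, l, t}"
  shows "card (edges X Y I) + card {v \<in> I. Y v < Y f} + card {v \<in> I. X v < X b} +
    card {v \<in> I. Y l < Y v} + card {v \<in> I. X t < X v} + card K \<le> card (edges X Y V)"
proof -
  let ?D = "Pair f ` {v \<in> I. Y v < Y f}" and ?L = "(\<lambda>v. (v, b)) ` {v \<in> I. X v < X b}"
  let ?U = "(\<lambda>v. (v, l)) ` {v \<in> I. Y l < Y v}" and ?R = "Pair t ` {v \<in> I. X t < X v}"
  have K: "finite K" using assms by (rule finite_subset) simp
  have nI: "f \<notin> I" "b \<notin> I" "l \<notin> I" "t \<notin> I" by (auto simp: I_def)
  have sub: "edges X Y I \<union> ?D \<union> ?L \<union> ?U \<union> ?R \<union> K \<subseteq> edges X Y V"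
    using assms corners strict by (auto simp: edges_def inverted_def I_def)
  have "card (edges X Y I \<union> ?D \<union> ?L \<union> ?U \<union> ?R \<union> K) = card (edges X Y I) + card ?D + card ?L + card ?U + card ?R + card K"
    using assms corners_distinct nI
    by (intro card_Un_eq refl finite_UnI finite_imageI finite_edges finite_I K) (auto simp: edges_def)
  also have "\<dots> = card (edges X Y I) + card {v \<in> I. Y v < Y f} + card {v \<in> I. X v < X b} +
      card {v \<in> I. Y l < Y v} + card {v \<in> I. X t < X v} + card K"
    by (simp add: card_image inj_on_def)
  finally show ?thesis using card_mono[OF _ sub] finite_V by simp
qed

text \<open>The case that the first entry is larger than the last one.  Every other entry is then inverted
  with at least one of the two.  The set \<open>Z\<close> in the proof consists of the entries that are inverted with exactly one corner.\<close>

lemma first_less_last: "Y f < Y l"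
proof (rule ccontr)
  assume "\<not> Y f < Y l"
  hence less: "Y l < Y f" using neq_Y corners corners_distinct by force
  define D where "D = {v \<in> I. Y v < Y f}"
  define L where "L = {v \<in> I. X v < X b}"
  define U where "U = {v \<in> I. Y l < Y v}"
  define R where "R = {v \<in> I. X t < X v}"
  define Z where "Z = I - L - R - (D \<inter> U)"
  note defs = D_def L_def U_def R_def
  have fin: "finite D" "finite L" "finite U" "finite R" "finite Z" by (auto simp: defs Z_def)
  have "D \<union> U = I" using less by (auto simp: defs)
  hence 1: "card D + card U = card I + card (D \<inter> U)" using fin card_Un_Int by metis
  have "I \<subseteq> (L \<union> R) \<union> ((D \<inter> U) \<union> Z)" by (auto simp: Z_def)
  hence "card I \<le> card ((L \<union> R) \<union> ((D \<inter> U) \<union> Z))" using fin by (intro card_mono) auto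
  also have "\<dots> \<le> card L + card R + (card (D \<inter> U) + card Z)"
    using card_Un_le[of "L \<union> R" "(D \<inter> U) \<union> Z"] card_Un_le[of L R] card_Un_le[of "D \<inter> U" Z] by linarith
  finally have 2: "card I \<le> card L + card R + (card (D \<inter> U) + card Z)" .
  have strip: "X b < X z \<and> X z < X t \<and> z \<in> I \<and> z \<in> V" if "z \<in> Z" for z
    using that neq_X[of z b] neq_X[of z t] corners by (force simp: Z_def defs I_def)
  have "\<exists>y\<in>I - Z. z \<searrow> y \<or> y \<searrow> z" if z: "z \<in> Z" for z
  proof -
    note s = strip[OF z]
    define k where "k = (if z \<in> D then f else l)"
    have "z \<noteq> k" "k \<in> {f, b, l, t}" using s by (auto simp: k_def I_def)
    then obtain y where y: "y \<in> V" "y \<noteq> k" "z \<searrow> y \<or> y \<searrow> z"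
      using neighbour[of z k] s by blast
    have "y \<noteq> b" "y \<noteq> t" using y s strict(2,4)[of z] by (auto simp: inverted_def I_def)
    moreover have "y \<notin> {f, l}"
    proof (cases "z \<in> D")
      case True
      hence "z \<notin> U" using z by (auto simp: Z_def)
      hence "Y z \<le> Y l" using s by (auto simp: U_def)
      moreover have "X z < X l" using s strict(3)[of z] by (auto simp: I_def)
      ultimately have "y \<noteq> l" using y(3) by (auto simp: inverted_def)
      thus ?thesis using y True by (auto simp: k_def)
    next
      case False
      hence "Y f \<le> Y z" using s by (auto simp: D_def)
      moreover have "X f < X z" using s strict(1)[of z] by (auto simp: I_def)
      ultimately have "y \<noteq> f" using y(3) by (auto simp: inverted_def)
      thus ?thesis using y False by (auto simp: k_def)
    qed
    ultimately have "y \<in> I" using y by (auto simp: I_def)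
    moreover have "y \<notin> Z"
    proof
      assume "y \<in> Z"
      note s' = strip[OF this]
      show False
        using y(3) avoid[of z y b t] avoid[of y z b t] s s' corners strict(2,4)[of y] strict(2,4)[of z]
        by (auto simp: I_def)
    qed
    ultimately show ?thesis using y by blast
  qed
  hence "card Z \<le> card {(u, v) \<in> edges X Y I. u \<in> Z \<and> v \<in> I - Z \<or> u \<in> I - Z \<and> v \<in> Z}"
    by (intro card_le_edges_leaving) (auto simp: Z_def)
  also have "\<dots> \<le> card (edges X Y I)" by (intro card_mono) auto
  finally have 3: "card Z \<le> card (edges X Y I)" .
  have "{(f, b), (f, l), (t, l)} \<subseteq> edges X Y {f, b, l, t}"
    using corners strict corners_distinct less by (auto simp: edges_def inverted_def)
  from corner_bound[OF this] have "card (edges X Y I) + card D + card L + card U + card R + 3 \<le> card (edges X Y V)"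
    using corners_distinct by (simp add: defs)
  thus False using 1 2 3 card_I count by linarith
qed

lemma bottom_left_of_top: "X b < X t"
proof -
  interpret S: residual_corners Y X V b f t l by (rule swap)
  show ?thesis by (rule S.first_less_last)
qed

text \<open>Each pair of a corner in \<open>{f, b}\<close> and a corner in \<open>{l, t}\<close> excludes, by 1324 avoidance, the edges
  lying between them.\<close>

lemma not_inverted:
  assumes "u \<in> V" "v \<in> V" "u \<searrow> v"
  shows "\<not> (Y f < Y v \<and> X v < X t)" "\<not> (X b < X u \<and> Y u < Y l)"
    "\<not> (X b < X u \<and> X v < X t)" "\<not> (Y f < Y v \<and> Y u < Y l)"
proof -
  have uv: "X u < X v" "Y v < Y u" using assms(3) by (auto simp: inverted_def)
  have st: "X f < X u \<or> u = f" "Y b < Y v \<or> v = b" "X v < X l \<or> v = l" "Y u < Y t \<or> u = t"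
    using strict assms by blast+
  show "\<not> (Y f < Y v \<and> X v < X t)"
    using avoid[OF assms(3), of f t] assms corners st uv by auto
  show "\<not> (X b < X u \<and> Y u < Y l)"
    using avoid[OF assms(3), of b l] assms corners st uv by auto
  show "\<not> (X b < X u \<and> X v < X t)"
    using avoid[OF assms(3), of b t] assms corners st uv by auto
  show "\<not> (Y f < Y v \<and> Y u < Y l)"
    using avoid[OF assms(3), of f l] assms corners st uv by auto
qed

text \<open>The cells: left of \<^term>\<open>b\<close>, central or right of \<^term>\<open>t\<close> (L, C, R), and down from \<^term>\<open>f\<close>, in the
  middle or up from \<^term>\<open>l\<close> (D, M, U).  The central middle cell is empty, see \<open>central_empty\<close> below.
  Edges at \<open>LD\<close> and at \<open>RU\<close> are counted without those at corners.\<close>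

definition LD :: "'v set" where "LD = {v \<in> I. X v < X b \<and> Y v < Y f}"
definition LM :: "'v set" where "LM = {v \<in> I. X v < X b \<and> Y f < Y v \<and> Y v < Y l}"
definition LU :: "'v set" where "LU = {v \<in> I. X v < X b \<and> Y l < Y v}"
definition CD :: "'v set" where "CD = {v \<in> I. X b < X v \<and> X v < X t \<and> Y v < Y f}"
definition CU :: "'v set" where "CU = {v \<in> I. X b < X v \<and> X v < X t \<and> Y l < Y v}"
definition RD :: "'v set" where "RD = {v \<in> I. X t < X v \<and> Y v < Y f}"
definition RM :: "'v set" where "RM = {v \<in> I. X t < X v \<and> Y f < Y v \<and> Y v < Y l}"
definition RU :: "'v set" where "RU = {v \<in> I. X t < X v \<and> Y l < Y v}"
definition edges_LD :: "('v \<times> 'v) set" where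
  "edges_LD = {(u, v) \<in> edges X Y I. u \<in> LD \<or> v \<in> LD}"
definition edges_RU :: "('v \<times> 'v) set" where
  "edges_RU = {(u, v) \<in> edges X Y I. u \<in> RU \<or> v \<in> RU}"

lemmas cells = LD_def LM_def LU_def CD_def CU_def RD_def RM_def RU_def

lemma I_in_V: "v \<in> I \<Longrightarrow> v \<in> V" by (simp add: I_def)

lemma I_neq: "v \<in> I \<Longrightarrow> X v \<noteq> X b \<and> X v \<noteq> X t \<and> Y v \<noteq> Y f \<and> Y v \<noteq> Y l"
  using neq_X neq_Y corners by (auto simp: I_def)

lemma finite_cells [simp]: "finite LD" "finite LM" "finite LU" "finite CD" "finite CU" "finite RD"
  "finite RM" "finite RU" "finite edges_LD" "finite edges_RU"
proof -
  show "finite LD" "finite LM" "finite LU" "finite CD" "finite CU" "finite RD" "finite RM" "finite RU"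
    by (simp_all add: cells)
  have "edges_LD \<subseteq> edges X Y I" "edges_RU \<subseteq> edges X Y I" by (auto simp: edges_LD_def edges_RU_def)
  thus "finite edges_LD" "finite edges_RU" by (auto intro: finite_subset)
qed

text \<open>An entry in the central cell would be an isolated vertex.\<close>

lemma central_empty:
  assumes "v \<in> I" "X b < X v" "X v < X t" "Y f < Y v" "Y v < Y l"
  shows False
proof -
  obtain y where y: "y \<in> V" "v \<searrow> y \<or> y \<searrow> v"
    using connected_on_neighbour[OF connected, of v f] assms(1) corners by (auto simp: I_def)
  thus False using not_inverted(1)[of y v] not_inverted(2)[of v y] assms I_in_V by auto
qed

lemma I_cells: "I = LD \<union> LM \<union> LU \<union> CD \<union> CU \<union> RD \<union> RM \<union> RU"
proof
  show "I \<subseteq> LD \<union> LM \<union> LU \<union> CD \<union> CU \<union> RD \<union> RM \<union> RU"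
  proof
    fix v assume v: "v \<in> I"
    show "v \<in> LD \<union> LM \<union> LU \<union> CD \<union> CU \<union> RD \<union> RM \<union> RU"
    proof -
      have "X v < X b \<or> (X b < X v \<and> X v < X t) \<or> X t < X v"
        "Y v < Y f \<or> (Y f < Y v \<and> Y v < Y l) \<or> Y l < Y v"
        using I_neq[OF v] by linarith+
      thus ?thesis using v central_empty[OF v] unfolding cells by blast
    qed
  qed
qed (auto simp: cells)

text \<open>What is left of the \<open>2n - 6\<close> edges after counting those at corners.\<close>

lemma edges_I_le: "card (edges X Y I) \<le> card LM + card CD + card CU + card RM"
proof -
  note o = first_less_last bottom_left_of_top
  have D: "{v \<in> I. Y v < Y f} = LD \<union> CD \<union> RD" using o I_neq by (subst I_cells) (auto simp: cells)
  have L: "{v \<in> I. X v < X b} = LD \<union> LM \<union> LU" using o by (subst I_cells) (auto simp: cells)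
  have U: "{v \<in> I. Y l < Y v} = LU \<union> CU \<union> RU" using o by (subst I_cells) (auto simp: cells)
  have R: "{v \<in> I. X t < X v} = RD \<union> RM \<union> RU" using o by (subst I_cells) (auto simp: cells)
  have "card I = card LD + card LM + card LU + card CD + card CU + card RD + card RM + card RU"
    unfolding I_cells using o by (intro card_Un_eq refl) (auto simp: cells)
  moreover have "card {v \<in> I. Y v < Y f} = card LD + card CD + card RD"
    unfolding D using o by (intro card_Un_eq refl) (auto simp: cells)
  moreover have "card {v \<in> I. X v < X b} = card LD + card LM + card LU"
    unfolding L using o by (intro card_Un_eq refl) (auto simp: cells)
  moreover have "card {v \<in> I. Y l < Y v} = card LU + card CU + card RU"
    unfolding U using o by (intro card_Un_eq refl) (auto simp: cells)
  moreover have "card {v \<in> I. X t < X v} = card RD + card RM + card RU"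
    unfolding R using o by (intro card_Un_eq refl) (auto simp: cells)
  moreover have "{(f, b), (t, l)} \<subseteq> edges X Y {f, b, l, t}"
    using corners strict corners_distinct by (auto simp: edges_def inverted_def)
  note corner_bound[OF this]
  moreover have "card {(f, b), (t, l)} = 2" using corners_distinct by simp
  ultimately show ?thesis using count card_I by linarith
qed

lemma inner_bound:
  "card LM * card CD + card CU * card RM + card LU * (card CD + card RM) +
   (card LM + card CU) * card RD + card LU * card RD + card edges_LD + card edges_RU
   \<le> card LM + card CD + card CU + card RM"
proof -
  note o = first_less_last bottom_left_of_top
  let ?U = "LM \<times> CD \<union> CU \<times> RM \<union> LU \<times> (CD \<union> RM) \<union> (LM \<union> CU) \<times> RD \<union> LU \<times> RD \<union> edges_LD \<union> edges_RU"
  have "CD \<inter> RM = {}" "LM \<inter> CU = {}" by (auto simp: cells)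
  hence "card (CD \<union> RM) = card CD + card RM" "card (LM \<union> CU) = card LM + card CU"
    by (simp_all add: card_Un_disjoint)
  moreover have "card ?U = card (LM \<times> CD) + card (CU \<times> RM) + card (LU \<times> (CD \<union> RM)) +
      card ((LM \<union> CU) \<times> RD) + card (LU \<times> RD) + card edges_LD + card edges_RU"
    using o by (intro card_Un_eq refl finite_UnI finite_cartesian_product finite_cells)
      (auto simp: cells edges_LD_def edges_RU_def edges_def inverted_def)
  moreover have "?U \<subseteq> edges X Y I"
    using o by (auto simp: cells edges_LD_def edges_RU_def edges_def inverted_def)
  hence "card ?U \<le> card (edges X Y I)" by (intro card_mono) auto
  ultimately show ?thesis using edges_I_le by (simp add: card_cartesian_product)
qed

text \<open>Otherwise no edge leaves the set formed by \<open>f\<close>, \<open>b\<close> and the cells \<open>LD\<close>, \<open>LM\<close>, \<open>CD\<close>.\<close>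

lemma LU_or_RD: "LU \<noteq> {} \<or> RD \<noteq> {}"
proof (rule ccontr)
  assume "\<not> (LU \<noteq> {} \<or> RD \<noteq> {})"
  hence empty: "LU = {}" "RD = {}" by auto
  note o = first_less_last bottom_left_of_top
  define S where "S = {f, b} \<union> LD \<union> LM \<union> CD"
  have "f \<in> S" "l \<notin> S" using corners_distinct by (auto simp: S_def cells I_def)
  then obtain x y where x: "x \<in> V" "x \<in> S" and y: "y \<in> V" "y \<notin> S" and e: "x \<searrow> y \<or> y \<searrow> x"
    using connected_on_crossing[OF connected] corners by blast
  have y': "y \<in> {l, t} \<union> CU \<union> RM \<union> RU"
    using y I_cells empty by (auto simp: S_def I_def)
  from e show False
  proof
    assume e: "x \<searrow> y"
    have "Y f < Y y" using y' o strict(4)[of f] corners corners_distinct by (auto simp: cells)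
    moreover have "Y x < Y l" using x o strict(2)[of l] corners corners_distinct by (auto simp: cells S_def)
    ultimately show False using not_inverted(4)[OF _ _ e] x y by blast
  next
    assume e: "y \<searrow> x"
    have "X b < X y" using y' o strict(3)[of b] corners corners_distinct by (auto simp: cells)
    moreover have "X x < X t" using x o strict(1)[of t] corners corners_distinct by (auto simp: cells S_def)
    ultimately show False using not_inverted(3)[OF _ _ e] x y by blast
  qed
qed

lemma not_LU_and_RD: "LU = {} \<or> RD = {}"
proof (rule ccontr)
  assume "\<not> (LU = {} \<or> RD = {})"
  hence "1 \<le> card LU" "1 \<le> card RD" by (simp_all add: Suc_le_eq card_gt_0_iff)
  hence "card CD + card RM \<le> card LU * (card CD + card RM)"
    "card LM + card CU \<le> (card LM + card CU) * card RD" "1 \<le> card LU * card RD"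
    by simp_all
  moreover have False if "x1 + x2 + x3 + x4 + x5 + x6 + x7 \<le> p + q + r + s" "q + s \<le> x3"
    "p + r \<le> x4" "1 \<le> x5" for x1 x2 x3 x4 x5 x6 x7 p q r s :: nat
    using that by linarith
  ultimately show False using inner_bound by blast
qed

text \<open>If a point of \<open>LD\<close> had no edge to \<open>LU\<close> or \<open>CD\<close>, it would form a 1324 with an edge between these cells
  and with \<open>t\<close>.\<close>

lemma edges_LD_nonempty:
  assumes "LU \<noteq> {}" "CD \<noteq> {}" "LD \<noteq> {}"
  shows "1 \<le> card edges_LD"
proof -
  note o = first_less_last bottom_left_of_top
  obtain u c d where m: "u \<in> LU" "c \<in> CD" "d \<in> LD" using assms by blast
  have "u \<searrow> c" using m o by (auto simp: cells inverted_def)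
  moreover have "Y u < Y t" using m strict(4)[of u] by (auto simp: cells I_def)
  ultimately have "\<not> (X d < X u \<and> Y d < Y c)"
    using avoid[of u c d t] m corners I_in_V by (auto simp: cells)
  moreover have "d \<noteq> u" "d \<noteq> c" using m o by (auto simp: cells)
  hence "X d \<noteq> X u" "Y d \<noteq> Y c" using m neq_X neq_Y I_in_V by (simp_all add: cells)
  ultimately have "u \<searrow> d \<or> d \<searrow> c" using m o by (auto simp: cells inverted_def)
  hence "edges_LD \<noteq> {}" using m by (auto simp: edges_LD_def edges_def cells)
  thus ?thesis by (simp add: Suc_le_eq card_gt_0_iff)
qed

text \<open>If \<open>RD\<close> and \<open>CD\<close> are empty, then after deleting \<open>b\<close> the points of
  \<open>LM\<close> have neighbours in \<open>LD\<close> only, and one more edge must connect \<open>f\<close>, \<open>LD\<close> and \<open>LM\<close> to the rest.\<close>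

lemma edges_LD_many:
  assumes "RD = {}" "CD = {}"
  shows "Suc (card LM) \<le> card edges_LD"
proof -
  note o = first_less_last bottom_left_of_top
  have row: "y = b \<or> y \<in> LD" if "y \<in> V" "Y y < Y f" for y
  proof -
    have "y \<notin> {f, l, t}" using that o top[of f] corners by auto
    hence "y = b \<or> y \<in> I" using that(1) by (auto simp: I_def)
    moreover have "y \<in> LD" if "y \<in> I"
    proof -
      have "y \<in> LD \<or> y \<in> LM \<or> y \<in> LU \<or> y \<in> CU \<or> y \<in> RM \<or> y \<in> RU"
        using that I_cells assms by blast
      thus ?thesis using \<open>Y y < Y f\<close> o by (auto simp: LM_def LU_def CU_def RM_def RU_def)
    qed
    ultimately show ?thesis by blast
  qed
  have LM_nbr: "y \<in> LD" if "x \<in> LM" "y \<in> V" "y \<noteq> b" "x \<searrow> y \<or> y \<searrow> x" for x y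
  proof -
    have x: "x \<in> V" "X x < X t" "Y f < Y x" "Y x < Y l" "X f < X x"
      using that o strict(1)[of x] by (auto simp: cells I_def)
    have xy: "x \<searrow> y" using that not_inverted(1)[of y x] x by blast
    hence "Y y \<le> Y f" using not_inverted(4)[OF x(1) that(2)] x by force
    moreover have "y \<noteq> f" using xy x(5) by (auto simp: inverted_def)
    ultimately have "Y y < Y f" using neq_Y that(2) corners by force
    thus ?thesis using row that by blast
  qed
  let ?E = "{(u, v) \<in> edges X Y I. u \<in> LM \<and> v \<in> LD \<or> u \<in> LD \<and> v \<in> LM}"
  have 1: "card LM \<le> card ?E"
  proof (rule card_le_edges_leaving)
    fix z assume z: "z \<in> LM"
    then obtain y where "y \<in> V" "y \<noteq> b" "z \<searrow> y \<or> y \<searrow> z"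
      using neighbour[of z b] by (auto simp: cells I_def)
    thus "\<exists>y\<in>LD. z \<searrow> y \<or> y \<searrow> z" using LM_nbr[OF z] by blast
  qed (auto simp: cells)
  define S where "S = {f} \<union> LD \<union> LM"
  have "\<exists>x y. x \<in> V - {b} \<and> y \<in> V - {b} \<and> x \<in> S \<and> y \<notin> S \<and> (x \<searrow> y \<or> y \<searrow> x)"
    using corners_distinct corners
    by (intro connected_on_crossing[OF connected_minus, of b f S l]) (auto simp: S_def cells I_def)
  then obtain x y where x: "x \<in> V" "x \<in> S" and y: "y \<in> V" "y \<notin> S" "y \<noteq> b" and e: "x \<searrow> y \<or> y \<searrow> x"
    by blast
  have nf: "x \<noteq> f"
  proof
    assume "x = f"
    hence "Y y < Y f" using e leftmost[OF y(1)] by (auto simp: inverted_def)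
    thus False using row y by (auto simp: S_def)
  qed
  moreover have "x \<notin> LM" using LM_nbr y e by (auto simp: S_def)
  ultimately have xL: "x \<in> LD" using x by (auto simp: S_def)
  have "y \<searrow> x"
  proof (rule ccontr)
    assume "\<not> y \<searrow> x"
    hence "Y y < Y f" using e xL by (auto simp: inverted_def cells)
    thus False using row y by (auto simp: S_def)
  qed
  moreover from this have "X y < X b" using xL by (auto simp: inverted_def cells)
  hence "y \<in> I" using y o strict(3)[of b] corners corners_distinct by (auto simp: I_def S_def)
  ultimately have "(y, x) \<in> edges_LD - ?E" using xL y by (auto simp: edges_LD_def edges_def cells S_def)
  hence "?E \<subset> edges_LD" by (auto simp: edges_LD_def)
  hence "card ?E < card edges_LD" by (intro psubset_card_mono) auto
  thus ?thesis using 1 by linarith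
qed

text \<open>The two preceding lemmas under the reflection, which exchanges \<open>LD\<close> with \<open>RU\<close>, \<open>LM\<close> with \<open>CU\<close> and
  \<open>CD\<close> with \<open>RM\<close>, and fixes \<open>LU\<close> and \<open>RD\<close>.\<close>

lemma RU_side:
  assumes "LU \<noteq> {}" "RD = {}"
  shows "RM = {} \<Longrightarrow> Suc (card CU) \<le> card edges_RU"
    and "RM \<noteq> {} \<Longrightarrow> RU \<noteq> {} \<Longrightarrow> 1 \<le> card edges_RU"
proof -
  interpret R: residual_corners "\<lambda>v. - Y v" "\<lambda>v. - X v" V t l b f by (rule reflect)
  have I: "R.I = I" by (auto simp: R.I_def I_def)
  have c: "R.LD = RU" "R.LM = CU" "R.LU = LU" "R.CD = RM" "R.RD = RD"
    by (auto simp: R.cells cells I)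
  have i: "inverted (\<lambda>v. - Y v) (\<lambda>v. - X v) = inverted X Y"
    by (auto simp: inverted_def fun_eq_iff)
  have e: "R.edges_LD = edges_RU"
    by (simp add: R.edges_LD_def edges_RU_def c I edges_def i)
  show "RM = {} \<Longrightarrow> Suc (card CU) \<le> card edges_RU"
    using R.edges_LD_many assms unfolding c e by blast
  show "RM \<noteq> {} \<Longrightarrow> RU \<noteq> {} \<Longrightarrow> 1 \<le> card edges_RU"
    using R.edges_LD_nonempty assms unfolding c e by blast
qed

lemma cell_structure:
  assumes "LU \<noteq> {}" "RD = {}"
  shows "card LU = 1" "LD = {}" "RU = {}" "CD \<noteq> {}" "RM \<noteq> {}"
    "card LM * (card CD - 1) + card CU * (card RM - 1) = 0"
proof -
  have u: "1 \<le> card LU" using assms(1) by (simp add: Suc_le_eq card_gt_0_iff)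
  have z: "card CD = 0 \<longleftrightarrow> CD = {}" "card RM = 0 \<longleftrightarrow> RM = {}" by simp_all
  define A where "A = (if card CD = 0 then 1 else card LM * (card CD - 1) + (card LU - 1) * card CD + card edges_LD)"
  define B where "B = (if card RM = 0 then 1 else card CU * (card RM - 1) + (card LU - 1) * card RM + card edges_RU)"
  (* A and B are the surpluses of the two sides, and the edge count leaves no room for either *)
  have "card LM + card CD + A \<le> card LM * card CD + card LU * card CD + card edges_LD"
    unfolding A_def using u edges_LD_many assms(2) by (intro edge_count_arithmetic) auto
  moreover have "card CU + card RM + B \<le> card CU * card RM + card LU * card RM + card edges_RU"
    unfolding B_def using u RU_side(1)[OF assms] by (intro edge_count_arithmetic) auto
  moreover have "card LM * card CD + card CU * card RM + (card LU * card CD + card LU * card RM) +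
      card edges_LD + card edges_RU \<le> card LM + card CD + card CU + card RM"
    using inner_bound assms(2) by (simp add: distrib_left)
  ultimately have AB: "A = 0" "B = 0" by linarith+
  show ne: "CD \<noteq> {}" "RM \<noteq> {}" using AB z by (auto simp: A_def B_def split: if_splits)
  show "card LU = 1" using AB u z ne by (auto simp: A_def)
  show "card LM * (card CD - 1) + card CU * (card RM - 1) = 0"
    using AB z ne by (auto simp: A_def B_def)
  have e: "card edges_LD = 0" "card edges_RU = 0" using AB z ne by (auto simp: A_def B_def)
  show "LD = {}" using edges_LD_nonempty assms(1) ne e by force
  show "RU = {}" using RU_side(2)[OF assms] ne e by force
qed

lemma inflated:
  assumes "LU \<noteq> {}" "RD = {}"
  shows "inflated_24153 X Y V"
proof -
  note o = first_less_last bottom_left_of_top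
  note s = cell_structure[OF assms]
  obtain w where w: "LU = {w}" using s(1) by (auto simp: card_1_singleton_iff)
  define A where "A = insert f LM"
  define C where "C = insert b CD"
  define D where "D = insert t CU"
  define E where "E = insert l RM"
  note blocks = A_def C_def D_def E_def
  have fin: "finite A" "finite C" "finite D" "finite E" by (simp_all add: blocks)
  have "f \<notin> LM" "b \<notin> CD" "t \<notin> CU" "l \<notin> RM" by (auto simp: cells I_def)
  hence cards: "card A = Suc (card LM)" "card C = Suc (card CD)" "card D = Suc (card CU)"
    "card E = Suc (card RM)" by (simp_all add: blocks)
  have wI: "w \<in> I" "X w < X b" "Y l < Y w" using w by (auto simp: cells)
  have V: "V = A \<union> {w} \<union> C \<union> D \<union> E"
  proof -
    have "V = {f, b, l, t} \<union> I" using corners by (auto simp: I_def)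
    thus ?thesis using I_cells s(2,3) assms(2) w by (auto simp: blocks)
  qed
  have inV: "A \<subseteq> V" "C \<subseteq> V" "D \<subseteq> V" "E \<subseteq> V" "w \<in> V" using V by auto
  have cor: "X f < X b" "X f < X t" "X f < X l" "X b < X l" "X t < X l"
    "Y b < Y f" "Y b < Y l" "Y b < Y t" "Y f < Y t" "Y l < Y t"
    using strict corners corners_distinct by metis+
  have A: "X v < X b \<and> Y f \<le> Y v \<and> Y v < Y l \<and> X f \<le> X v" if "v \<in> A" for v
    using that cor o leftmost inV by (auto simp: A_def cells)
  have C: "X b \<le> X v \<and> X v < X t \<and> Y v < Y f \<and> Y b \<le> Y v" if "v \<in> C" for v
    using that cor o bottom inV by (auto simp: C_def cells)
  have D: "X b < X v \<and> X v \<le> X t \<and> Y l < Y v \<and> Y v \<le> Y t" if "v \<in> D" for v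
    using that cor o top inV by (auto simp: D_def cells)
  have E: "X t < X v \<and> Y f < Y v \<and> Y v \<le> Y l \<and> X v \<le> X l" if "v \<in> E" for v
    using that cor o rightmost inV by (auto simp: E_def cells)
  have inc: "X u < X v \<longleftrightarrow> Y u < Y v"
    if "u \<in> V" "v \<in> V" "\<not> u \<searrow> v" "\<not> v \<searrow> u" for u v
  proof (cases "u = v")
    case False
    thus ?thesis using that neq_X[OF that(1,2)] neq_Y[OF that(1,2)] unfolding inverted_def by linarith
  qed simp
  have incA: "X u < X v \<longleftrightarrow> Y u < Y v" if "u \<in> A" "v \<in> A" for u v
  proof (rule inc)
    have "\<not> u \<searrow> v" if "u \<in> A" "v \<in> A" for u v
    proof
      assume "u \<searrow> v"
      moreover have "v \<noteq> f" using \<open>u \<searrow> v\<close> A[OF that(1)] by (auto simp: inverted_def)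
      hence "Y f < Y v" using A[OF that(2)] neq_Y[of v f] inV that corners by force
      ultimately show False
        using not_inverted(4)[of u v] A[OF that(1)] that inV by blast
    qed
    thus "\<not> u \<searrow> v" "\<not> v \<searrow> u" using that by blast+
  qed (use that inV in auto)
  have incC: "X u < X v \<longleftrightarrow> Y u < Y v" if "u \<in> C" "v \<in> C" for u v
  proof (rule inc)
    have "\<not> u \<searrow> v" if "u \<in> C" "v \<in> C" for u v
    proof
      assume "u \<searrow> v"
      moreover have "u \<noteq> b" using \<open>u \<searrow> v\<close> C[OF that(2)] by (auto simp: inverted_def)
      hence "X b < X u" using C[OF that(1)] neq_X[of u b] inV that corners by force
      ultimately show False
        using not_inverted(3)[of u v] C[OF that(2)] that inV by blast
    qed
    thus "\<not> u \<searrow> v" "\<not> v \<searrow> u" using that by blast+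
  qed (use that inV in auto)
  have incD: "X u < X v \<longleftrightarrow> Y u < Y v" if "u \<in> D" "v \<in> D" for u v
  proof (rule inc)
    have "\<not> u \<searrow> v" if "u \<in> D" "v \<in> D" for u v
    proof
      assume "u \<searrow> v"
      moreover have "v \<noteq> t" using \<open>u \<searrow> v\<close> D[OF that(1)] by (auto simp: inverted_def)
      hence "X v < X t" using D[OF that(2)] neq_X[of v t] inV that corners by force
      ultimately show False
        using not_inverted(3)[of u v] D[OF that(1)] that inV by blast
    qed
    thus "\<not> u \<searrow> v" "\<not> v \<searrow> u" using that by blast+
  qed (use that inV in auto)
  have incE: "X u < X v \<longleftrightarrow> Y u < Y v" if "u \<in> E" "v \<in> E" for u v
  proof (rule inc)
    have "\<not> u \<searrow> v" if "u \<in> E" "v \<in> E" for u v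
    proof
      assume "u \<searrow> v"
      moreover have "u \<noteq> l" using \<open>u \<searrow> v\<close> E[OF that(2)] by (auto simp: inverted_def)
      hence "Y u < Y l" using E[OF that(1)] neq_Y[of u l] inV that corners by force
      ultimately show False
        using not_inverted(4)[of u v] E[OF that(2)] that inV by blast
    qed
    thus "\<not> u \<searrow> v" "\<not> v \<searrow> u" using that by blast+
  qed (use that inV in auto)
  (* the order of the blocks by position is A, w, C, D, E *)
  have XAw: "X u < X w" if "u \<in> A" for u
  proof (rule ccontr)
    assume "\<not> X u < X w"
    hence "X w < X u" using neq_X[of u w] A[OF that] inV that wI by force
    hence "w \<searrow> u" using A[OF that] wI by (auto simp: inverted_def)
    moreover have "u \<noteq> f" using \<open>X w < X u\<close> leftmost[OF inV(5)] by auto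
    hence "Y f < Y u" using A[OF that] neq_Y[of u f] inV that corners by force
    ultimately show False using not_inverted(1)[of w u] A[OF that] o inV that by auto
  qed
  have XCD: "X u < X v" if "u \<in> C" "v \<in> D" for u v
  proof (rule ccontr)
    assume "\<not> X u < X v"
    hence "X v < X u" using neq_X[of u v] C[OF that(1)] D[OF that(2)] o inV that by force
    hence "v \<searrow> u" using C[OF that(1)] D[OF that(2)] o by (auto simp: inverted_def)
    thus False using not_inverted(3)[of v u] C[OF that(1)] D[OF that(2)] inV that by blast
  qed
  (* the order of the blocks by value is C, A, E, w, D *)
  have YAE: "Y u < Y v" if "u \<in> A" "v \<in> E" for u v
  proof (rule ccontr)
    assume "\<not> Y u < Y v"
    hence "Y v < Y u" using neq_Y[of u v] A[OF that(1)] E[OF that(2)] o inV that by force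
    hence "u \<searrow> v" using A[OF that(1)] E[OF that(2)] o by (auto simp: inverted_def)
    thus False using not_inverted(4)[of u v] A[OF that(1)] E[OF that(2)] inV that by blast
  qed
  have YwD: "Y w < Y v" if "v \<in> D" for v
  proof (rule ccontr)
    assume "\<not> Y w < Y v"
    hence "Y v < Y w" using neq_Y[of w v] D[OF that] inV that wI by force
    hence "w \<searrow> v" using D[OF that] wI by (auto simp: inverted_def)
    moreover have "v \<noteq> t" using \<open>Y v < Y w\<close> top[OF inV(5)] by auto
    hence "X v < X t" using D[OF that] neq_X[of v t] inV that corners by force
    ultimately show False using not_inverted(1)[of w v] D[OF that] o inV that by auto
  qed
  have Xord: "\<And>u v. u \<in> A \<Longrightarrow> v \<in> C \<Longrightarrow> X u < X v" "\<And>u v. u \<in> A \<Longrightarrow> v \<in> D \<Longrightarrow> X u < X v"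
    "\<And>u v. u \<in> A \<Longrightarrow> v \<in> E \<Longrightarrow> X u < X v" "\<And>v. v \<in> C \<Longrightarrow> X w < X v" "\<And>v. v \<in> D \<Longrightarrow> X w < X v"
    "\<And>v. v \<in> E \<Longrightarrow> X w < X v" "\<And>u v. u \<in> C \<Longrightarrow> v \<in> E \<Longrightarrow> X u < X v"
    "\<And>u v. u \<in> D \<Longrightarrow> v \<in> E \<Longrightarrow> X u < X v"
    using A C D E wI o by force+
  have Yord: "\<And>u v. u \<in> C \<Longrightarrow> v \<in> A \<Longrightarrow> Y u < Y v" "\<And>u v. u \<in> C \<Longrightarrow> v \<in> E \<Longrightarrow> Y u < Y v"
    "\<And>u v. u \<in> C \<Longrightarrow> v \<in> D \<Longrightarrow> Y u < Y v" "\<And>v. v \<in> C \<Longrightarrow> Y v < Y w" "\<And>v. v \<in> A \<Longrightarrow> Y v < Y w"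
    "\<And>v. v \<in> E \<Longrightarrow> Y v < Y w" "\<And>u v. u \<in> A \<Longrightarrow> v \<in> D \<Longrightarrow> Y u < Y v"
    "\<And>u v. u \<in> E \<Longrightarrow> v \<in> D \<Longrightarrow> Y u < Y v"
    using A C D E wI o by force+
  note order = XAw XCD YAE YwD Xord Yord
  have disj: "A \<inter> C = {}" "A \<inter> D = {}" "A \<inter> E = {}" "C \<inter> D = {}" "C \<inter> E = {}" "D \<inter> E = {}"
    "w \<notin> A" "w \<notin> C" "w \<notin> D" "w \<notin> E"
    using order less_irrefl by blast+
  have cardU: "card {w} = 1" "card (A \<union> {w}) = card A + 1" "card (A \<union> {w} \<union> C) = card A + 1 + card C"
    "card (A \<union> {w} \<union> C \<union> D) = card A + 1 + card C + card D"
    "card (C \<union> A) = card C + card A" "card (C \<union> A \<union> E) = card C + card A + card E"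
    "card (C \<union> A \<union> E \<union> {w}) = card C + card A + card E + 1"
    "card V = card A + 1 + card C + card D + card E"
    unfolding V using fin disj disj(1)[unfolded Int_commute[of A]]
    by (simp_all add: card_Un_disjoint Int_Un_distrib2)
  have "parameters (card V) (card A) (card C) (card D) (card E)"
    unfolding parameters_def cards using s(4-6) cardU(8)
    by (simp add: cards Suc_le_eq card_gt_0_iff)
  moreover have "rank Y V v = phi (card A) (card C) (card D) (card E) (rank X V v)" if v: "v \<in> V" for v
  proof -
    consider "v \<in> A" | "v \<in> {w}" | "v \<in> C" | "v \<in> D" | "v \<in> E" using v V by blast
    thus ?thesis
    proof cases
      case 1
      have "\<exists>r < card A. rank X V v = card ({} :: 'v set) + r \<and> rank Y V v = card C + r"
      proof (rule rank_in_block[OF finite_V _ _ 1])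
        show "V = {} \<union> A \<union> ({w} \<union> C \<union> D \<union> E)" "V = C \<union> A \<union> (E \<union> {w} \<union> D)"
          unfolding V by blast+
      qed (use disj order incA in auto)
      thus ?thesis by (auto simp: phi_def)
    next
      case 2
      have "\<exists>r < card {w}. rank X V v = card A + r \<and> rank Y V v = card (C \<union> A \<union> E) + r"
      proof (rule rank_in_block[OF finite_V _ _ 2])
        show "V = A \<union> {w} \<union> (C \<union> D \<union> E)" "V = (C \<union> A \<union> E) \<union> {w} \<union> (D)"
          unfolding V by blast+
      qed (use disj order  in auto)
      thus ?thesis unfolding cardU by (auto simp: phi_def)
    next
      case 3
      have "\<exists>r < card C. rank X V v = card (A \<union> {w}) + r \<and> rank Y V v = card ({} :: 'v set) + r"
      proof (rule rank_in_block[OF finite_V _ _ 3])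
        show "V = (A \<union> {w}) \<union> C \<union> (D \<union> E)" "V = {} \<union> C \<union> (A \<union> E \<union> {w} \<union> D)"
          unfolding V by blast+
      qed (use disj order incC in auto)
      thus ?thesis unfolding cardU by (auto simp: phi_def)
    next
      case 4
      have "\<exists>r < card D. rank X V v = card (A \<union> {w} \<union> C) + r \<and> rank Y V v = card (C \<union> A \<union> E \<union> {w}) + r"
      proof (rule rank_in_block[OF finite_V _ _ 4])
        show "V = (A \<union> {w} \<union> C) \<union> D \<union> (E)" "V = (C \<union> A \<union> E \<union> {w}) \<union> D \<union> ({})"
          unfolding V by blast+
      qed (use disj order incD in auto)
      thus ?thesis unfolding cardU by (auto simp: phi_def)
    next
      case 5
      have "\<exists>r < card E. rank X V v = card (A \<union> {w} \<union> C \<union> D) + r \<and> rank Y V v = card (C \<union> A) + r"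
      proof (rule rank_in_block[OF finite_V _ _ 5])
        show "V = (A \<union> {w} \<union> C \<union> D) \<union> E \<union> ({})" "V = (C \<union> A) \<union> E \<union> ({w} \<union> D)"
          unfolding V by blast+
      qed (use disj order incE in auto)
      thus ?thesis unfolding cardU by (auto simp: phi_def)
    qed
  qed
  ultimately show ?thesis unfolding inflated_24153_def by blast
qed

lemma inflated_or_inverse: "inflated_24153 X Y V \<or> inflated_24153 Y X V"
proof -
  interpret S: residual_corners Y X V b f t l by (rule swap)
  have I: "S.I = I" by (auto simp: S.I_def I_def)
  have "S.LU = RD" "S.RD = LU" by (auto simp: S.cells cells I)
  thus ?thesis using LU_or_RD not_LU_and_RD inflated S.inflated by auto
qed

end

theorem residual_points_imp_inflated:
  assumes "finite V" "inj_on X V" "inj_on Y V" "residual_points X Y V"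
  shows "inflated_24153 X Y V \<or> inflated_24153 Y X V"
proof -
  have "3 \<le> card V" using assms(4) unfolding residual_points_def by linarith
  hence ne: "V \<noteq> {}" by auto
  have min: "\<exists>m\<in>V. \<forall>v\<in>V. g m \<le> g v" for g :: "'a \<Rightarrow> int"
  proof -
    have "Min (g ` V) \<in> g ` V" using assms(1) ne by (intro Min_in) auto
    then obtain m where m: "m \<in> V" "Min (g ` V) = g m" by blast
    have "g m \<le> g v" if "v \<in> V" for v
      unfolding m(2)[symmetric] using assms(1) that by (intro Min_le) auto
    thus ?thesis using m(1) by blast
  qed
  obtain f b l t where "f \<in> V" "\<forall>v\<in>V. X f \<le> X v" "b \<in> V" "\<forall>v\<in>V. Y b \<le> Y v"
    "l \<in> V" "\<forall>v\<in>V. X v \<le> X l" "t \<in> V" "\<forall>v\<in>V. Y v \<le> Y t"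
    using min[of X] min[of Y] min[of "\<lambda>v. - X v"] min[of "\<lambda>v. - Y v"] by auto
  then interpret residual_corners X Y V f b l t
    using assms by unfold_locales auto
  show ?thesis by (rule inflated_or_inverse)
qed

section \<open>Inflations are residual\<close>

lemma rank_less_iff:
  assumes "finite V" "u \<in> V" "v \<in> V"
  shows "rank X V u < rank X V v \<longleftrightarrow> X u < X v"
proof -
  have mono: "rank X V u < rank X V v" if "X u < X v" "u \<in> V" for u v
  proof -
    have "u \<notin> {z \<in> V. X z < X u}" "u \<in> {z \<in> V. X z < X v}" using that by auto
    moreover have "{z \<in> V. X z < X u} \<subseteq> {z \<in> V. X z < X v}" using that(1) by auto
    ultimately have "{z \<in> V. X z < X u} \<subset> {z \<in> V. X z < X v}" by blast
    thus ?thesis unfolding rank_def using assms(1) by (intro psubset_card_mono) auto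
  qed
  consider "X u < X v" | "X u = X v" | "X v < X u" by linarith
  thus ?thesis
  proof cases
    case 2
    thus ?thesis by (simp add: rank_def)
  qed (use mono assms in \<open>auto dest: less_asym\<close>)
qed

lemma bij_betw_rank:
  assumes "finite V" "inj_on X V"
  shows "bij_betw (rank X V) V {..<card V}"
proof -
  have inj: "inj_on (rank X V) V"
  proof (rule inj_onI)
    fix u v assume "u \<in> V" "v \<in> V" "rank X V u = rank X V v"
    hence "X u = X v" using rank_less_iff[OF assms(1)] by (metis linorder_neqE_linordered_idom less_irrefl)
    thus "u = v" using assms(2) \<open>u \<in> V\<close> \<open>v \<in> V\<close> by (simp add: inj_on_eq_iff)
  qed
  have "rank X V v < card V" if "v \<in> V" for v
    unfolding rank_def using assms(1) that by (intro psubset_card_mono) auto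
  hence "rank X V ` V \<subseteq> {..<card V}" by auto
  moreover have "card (rank X V ` V) = card {..<card V}" using inj by (simp add: card_image)
  ultimately have "rank X V ` V = {..<card V}" by (intro card_subset_eq) auto
  thus ?thesis using inj by (simp add: bij_betw_def)
qed

lemma phi_inversion_iff:
  assumes "n = a + 1 + c + d + e" "i < j" "j < n"
  shows "phi a c d e j < phi a c d e i \<longleftrightarrow>
    i \<le> a \<and> a < j \<and> j \<le> a + c \<or> i = a \<and> a + c + d < j \<or> a + c < i \<and> i \<le> a + c + d \<and> a + c + d < j"
  using assms by (auto simp: phi_def)

text \<open>An inflation has \<open>(a + 1) c + e + d e\<close> inversions.\<close>

lemma parameters_count:
  assumes "parameters n a c d e"
  shows "(a + 1) * c + e + d * e + 6 = 2 * n"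
proof -
  have "a \<ge> 1" "d \<ge> 1" "c \<ge> 2" "e \<ge> 2" using assms by (auto simp: parameters_def)
  then obtain a' c' d' e' where "a = a' + 1" "d = d' + 1" "c = c' + 2" "e = e' + 2"
    by (metis add.commute le_Suc_ex)
  thus ?thesis using assms by (auto simp: parameters_def algebra_simps)
qed

text \<open>Edges join the first block to the third, the single point to the third and the fifth, and the fourth
  block to the fifth.  The third and fifth blocks have at least two points, so the graph stays connected when
  a point other than the single point is deleted.\<close>

theorem inflated_imp_residual_points:
  assumes fin: "finite V" and inj: "inj_on X V" "inj_on Y V" and infl: "inflated_24153 X Y V"
  shows "residual_points X Y V"
proof -
  obtain a c d e where par: "parameters (card V) a c d e"
    and phi: "\<And>v. v \<in> V \<Longrightarrow> rank Y V v = phi a c d e (rank X V v)"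
    using infl by (auto simp: inflated_24153_def)
  let ?x = "rank X V"
  note bij = bij_betw_rank[OF fin inj(1)]
  have n: "card V = a + 1 + c + d + e" "1 \<le> a" "1 \<le> d" "2 \<le> c" "2 \<le> e"
    using par by (auto simp: parameters_def)
  have xlt: "?x v < a + 1 + c + d + e" if "v \<in> V" for v
    using bij_betwE[OF bij] that n(1) by auto
  have pick: "\<exists>v\<in>V. ?x v = i" if "i < card V" for i
    using bij that unfolding bij_betw_def by (metis imageE lessThan_iff)
  have X: "X u < X v \<longleftrightarrow> ?x u < ?x v" if "u \<in> V" "v \<in> V" for u v
    using rank_less_iff[OF fin that] by blast
  have Y: "Y u < Y v \<longleftrightarrow> phi a c d e (?x u) < phi a c d e (?x v)" if "u \<in> V" "v \<in> V" for u v
    using rank_less_iff[OF fin that] phi that by metis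
  have inv: "inverted X Y u v \<longleftrightarrow> ?x u < ?x v \<and> (?x u \<le> a \<and> a < ?x v \<and> ?x v \<le> a + c \<or>
      ?x u = a \<and> a + c + d < ?x v \<or> a + c < ?x u \<and> ?x u \<le> a + c + d \<and> a + c + d < ?x v)"
    if "u \<in> V" "v \<in> V" for u v
    using phi_inversion_iff[OF n(1), of "?x u" "?x v"] xlt[OF that(2)] n(1)
    unfolding inverted_def X[OF that] Y[OF that(2,1)] by auto
  have avoid: "avoiding X Y V"
    unfolding avoiding_def
  proof safe
    fix s u v g
    assume m: "s \<in> V" "u \<in> V" "v \<in> V" "g \<in> V"
      and *: "X s < X u" "X u < X v" "X v < X g" "Y s < Y v" "Y v < Y u" "Y u < Y g"
    (* the pairs s, v and u, g are not inverted, whereas u, v is *)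
    have "inverted X Y u v" "\<not> inverted X Y s v" "\<not> inverted X Y u g"
      "?x s < ?x u" "?x u < ?x v" "?x v < ?x g"
      using * m X by (auto simp: inverted_def)
    thus False using inv m by auto
  qed
  define J where "J = {..a} \<times> {a<..a+c} \<union> {a} \<times> {a+c+d<..<card V} \<union> {a+c<..a+c+d} \<times> {a+c+d<..<card V}"
  have "bij_betw (map_prod ?x ?x) (edges X Y V) J"
  proof (rule bij_betw_imageI)
    show "inj_on (map_prod ?x ?x) (edges X Y V)"
      using bij unfolding bij_betw_def inj_on_def edges_def by auto
    show "map_prod ?x ?x ` edges X Y V = J"
    proof
      show "map_prod ?x ?x ` edges X Y V \<subseteq> J"
        using xlt n(1) by (auto simp: edges_def J_def inv)
      show "J \<subseteq> map_prod ?x ?x ` edges X Y V"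
      proof
        fix z assume z: "z \<in> J"
        obtain i j where ij: "z = (i, j)" by (cases z)
        have "i < card V" "j < card V" using z n(1) ij by (auto simp: J_def)
        then obtain u v where uv: "u \<in> V" "v \<in> V" "?x u = i" "?x v = j" using pick by metis
        hence "(u, v) \<in> edges X Y V" using z ij by (auto simp: edges_def J_def inv)
        thus "z \<in> map_prod ?x ?x ` edges X Y V" using uv ij by (metis imageI map_prod_simp)
      qed
    qed
  qed
  hence "card (edges X Y V) = card J" by (rule bij_betw_same_card)
  also have "\<dots> = (a + 1) * c + 1 * e + d * e"
    unfolding J_def
  proof (intro card_Un_eq)
    show "card ({..a} \<times> {a<..a+c}) = (a + 1) * c" by (simp add: card_cartesian_product)
    show "card ({a} \<times> {a+c+d<..<card V}) = 1 * e" using n(1) by (simp add: card_cartesian_product)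
    show "card ({a+c<..a+c+d} \<times> {a+c+d<..<card V}) = d * e" using n(1) by (simp add: card_cartesian_product)
  qed auto
  finally have count: "int (card (edges X Y V)) = 2 * int (card V) - 6"
    using parameters_count[OF par] by linarith
  obtain w where w: "w \<in> V" "?x w = a" using pick[of a] n(1) by auto
  have conn: "connected_on X Y W"
    if W: "W \<subseteq> V" "w \<in> W" "c0 \<in> W" "e0 \<in> W" and c0: "a < ?x c0" "?x c0 \<le> a + c"
      and e0: "a + c + d < ?x e0" for W c0 e0
    unfolding connected_on_def
  proof (intro allI impI, rule ccontr)
    fix S assume S: "(\<exists>u\<in>W. u \<in> S) \<and> (\<exists>v\<in>W. v \<notin> S)"
      and "\<not> (\<exists>u\<in>W. \<exists>v\<in>W. inverted X Y u v \<and> (u \<in> S) \<noteq> (v \<in> S))"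
    hence same: "(u \<in> S) = (v \<in> S)" if "u \<in> W" "v \<in> W" "inverted X Y u v" for u v using that by blast
    have wc: "inverted X Y w c0" and we: "inverted X Y w e0" using W w c0 e0 inv by auto
    have "(u \<in> S) = (w \<in> S)" if u: "u \<in> W" for u
    proof -
      have uV: "u \<in> V" using u W by blast
      consider "?x u \<le> a" | "a < ?x u \<and> ?x u \<le> a + c" | "a + c < ?x u \<and> ?x u \<le> a + c + d" | "a + c + d < ?x u"
        by linarith
      thus ?thesis
      proof cases
        case 1
        hence "inverted X Y u c0" using uV W c0 inv by auto
        thus ?thesis using same wc u W by blast
      next
        case 2
        hence "inverted X Y w u" using uV w inv by auto
        thus ?thesis using same u W by blast
      next
        case 3
        hence "inverted X Y u e0" using uV W e0 inv by auto
        thus ?thesis using same we u W by blast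
      next
        case 4
        hence "inverted X Y w u" using uV w inv by auto
        thus ?thesis using same u W by blast
      qed
    qed
    thus False using S by blast
  qed
  obtain c1 c2 e1 e2 where ce: "c1 \<in> V" "?x c1 = a + 1" "c2 \<in> V" "?x c2 = a + 2"
    "e1 \<in> V" "?x e1 = a + c + d + 1" "e2 \<in> V" "?x e2 = a + c + d + 2"
    using pick[of "a + 1"] pick[of "a + 2"] pick[of "a + c + d + 1"] pick[of "a + c + d + 2"] n by auto
  have "connected_on X Y V" using conn[of V c1 e1] w ce n by auto
  moreover have "connected_on X Y (V - {k})" if k: "extreme X Y V k" for k
  proof -
    have "k \<noteq> w"
    proof
      assume kw: "k = w"
      obtain z0 z1 where z: "z0 \<in> V" "?x z0 = 0" "z1 \<in> V" "?x z1 = a + c + 1"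
        using pick[of 0] pick[of "a + c + 1"] n by auto
      have "X z0 < X w" "Y z0 < Y w" "X w < X z1" "Y w < Y z1"
        using z w n X Y by (simp_all add: phi_def)
      thus False using k kw z unfolding extreme_def by fastforce
    qed
    define c0 where "c0 = (if k = c1 then c2 else c1)"
    define e0 where "e0 = (if k = e1 then e2 else e1)"
    have "c1 \<noteq> c2" "e1 \<noteq> e2" using ce by auto
    thus ?thesis using conn[of "V - {k}" c0 e0] w ce n \<open>k \<noteq> w\<close> by (auto simp: c0_def e0_def)
  qed
  ultimately show ?thesis using avoid count unfolding residual_points_def by blast
qed

section \<open>The two families\<close>

text \<open>The inverse of \<^term>\<open>phi a c d e\<close>, an inflation of 31524 with increasing blocks of sizes
  \<open>c\<close>, \<open>a\<close>, \<open>e\<close>, \<open>1\<close>, \<open>d\<close>.\<close>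

definition psi :: "nat \<Rightarrow> nat \<Rightarrow> nat \<Rightarrow> nat \<Rightarrow> nat \<Rightarrow> nat" where
  "psi a c d e i =
     (if i < c then i + a + 1 else if i < a + c then i - c else if i < a + c + e then i + d + 1
      else if i = a + c + e then a else i - e)"

lemma psi_phi: "i < a + 1 + c + d + e \<Longrightarrow> psi a c d e (phi a c d e i) = i"
  by (auto simp: phi_def psi_def)

lemma phi_psi: "i < a + 1 + c + d + e \<Longrightarrow> phi a c d e (psi a c d e i) = i"
  by (auto simp: phi_def psi_def)

lemma phi_less: "i < a + 1 + c + d + e \<Longrightarrow> phi a c d e i < a + 1 + c + d + e"
  by (auto simp: phi_def)

lemma psi_less: "i < a + 1 + c + d + e \<Longrightarrow> psi a c d e i < a + 1 + c + d + e"
  by (auto simp: psi_def)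

lemma permutation_of_bijection:
  assumes "\<And>i. i < n \<Longrightarrow> g i < n" "\<And>i. i < n \<Longrightarrow> h i < n" "\<And>i. i < n \<Longrightarrow> g (h i) = i"
    "\<And>i. i < n \<Longrightarrow> h (g i) = i"
  shows "map (\<lambda>i. Suc (g i)) [0..<n] \<in> permutations_of_set {1..n}"
proof (rule permutations_of_setI)
  have "g ` {..<n} = {..<n}" using assms by (force simp: image_iff)
  hence "(\<lambda>i. Suc (g i)) ` {..<n} = Suc ` {..<n}" by (metis image_image)
  thus "set (map (\<lambda>i. Suc (g i)) [0..<n]) = {1..n}"
    by (auto simp: lessThan_atLeast0 image_Suc_lessThan)
  have "inj_on g {..<n}" using assms(4) by (metis inj_on_inverseI lessThan_iff)
  thus "distinct (map (\<lambda>i. Suc (g i)) [0..<n])"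
    by (auto simp: distinct_map inj_on_def)
qed

lemma sum_filter_lessThan:
  fixes n :: nat
  shows "(\<Sum>j | j < n \<and> P j. f j) = (\<Sum>j<n. if P j then f j else (0::nat))"
proof -
  have "{j. j < n \<and> P j} = {j \<in> {..<n}. P j}" by auto
  thus ?thesis by (simp only: sum.inter_filter[OF finite_lessThan])
qed

lemma length_iota [simp]: "length (iota m) = m"
  by (simp add: iota_def)

lemma map_add_iota: "map (\<lambda>x. s + x) (iota m) = map (\<lambda>i. Suc (s + i)) [0..<m]"
  by (rule nth_equalityI) (auto simp: iota_def simp del: upt_Suc)

lemma upto5: "[0..<5] = [0, 1, 2, 3, 4]" "{..<5::nat} = {0, 1, 2, 3, 4}"
  by (auto simp: upt_rec)

lemma inflation_24153_eq:
  "inflation [2, 4, 1, 5, 3] [iota a, iota 1, iota c, iota d, iota e] =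
     map (\<lambda>i. Suc (phi a c d e i)) [0..<a + 1 + c + d + e]"
proof -
  have "inflation [2, 4, 1, 5, 3] [iota a, iota 1, iota c, iota d, iota e] =
     map (\<lambda>i. Suc (c + i)) [0..<a] @ map (\<lambda>i. Suc (a + c + e + i)) [0..<1] @ map (\<lambda>i. Suc (0 + i)) [0..<c] @
     map (\<lambda>i. Suc (a + 1 + c + e + i)) [0..<d] @ map (\<lambda>i. Suc (a + c + i)) [0..<e]"
    unfolding map_add_iota[symmetric]
    by (simp add: inflation_def sum_filter_lessThan upto5 map_idI ac_simps)
  also have "\<dots> = map (\<lambda>i. Suc (phi a c d e i)) [0..<a + 1 + c + d + e]"
    by (rule nth_equalityI) (auto simp: nth_append phi_def)
  finally show ?thesis .
qed

lemma inflation_31524_eq: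
  "inflation [3, 1, 5, 2, 4] [iota c, iota a, iota e, iota 1, iota d] =
     map (\<lambda>i. Suc (psi a c d e i)) [0..<a + 1 + c + d + e]"
proof -
  have "inflation [3, 1, 5, 2, 4] [iota c, iota a, iota e, iota 1, iota d] =
     map (\<lambda>i. Suc (a + 1 + i)) [0..<c] @ map (\<lambda>i. Suc (0 + i)) [0..<a] @ map (\<lambda>i. Suc (c + a + 1 + d + i)) [0..<e] @
     map (\<lambda>i. Suc (a + i)) [0..<1] @ map (\<lambda>i. Suc (c + a + 1 + i)) [0..<d]"
    unfolding map_add_iota[symmetric]
    by (simp add: inflation_def sum_filter_lessThan upto5 map_idI ac_simps)
  also have "\<dots> = map (\<lambda>i. Suc (psi a c d e i)) [0..<a + 1 + c + d + e]"
    by (rule nth_equalityI) (auto simp: nth_append psi_def)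
  finally show ?thesis .
qed

lemma rank_position: "i < n \<Longrightarrow> rank int {..<n} i = i"
proof -
  assume "i < n"
  hence "{u \<in> {..<n}. int u < int i} = {..<i}" by auto
  thus ?thesis by (simp add: rank_def)
qed

lemma rank_entry:
  assumes p: "p \<in> permutations_of_set {1..n}" and i: "i < n"
  shows "rank (\<lambda>i. int (p ! i)) {..<n} i = p ! i - 1"
proof -
  note P = permutation_facts[OF p]
  let ?U = "{u \<in> {..<n}. p ! u < p ! i}"
  have "(!) p ` ?U = {1..<p ! i}"
  proof
    show "(!) p ` ?U \<subseteq> {1..<p ! i}" using P(5) by auto
    show "{1..<p ! i} \<subseteq> (!) p ` ?U"
    proof
      fix x assume x: "x \<in> {1..<p ! i}"
      hence "x \<in> set p" using P(3) P(5)[OF i] by auto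
      then obtain u where "u < n" "p ! u = x" using P(1) by (auto simp: in_set_conv_nth)
      thus "x \<in> (!) p ` ?U" using x by auto
    qed
  qed
  moreover have "inj_on ((!) p) ?U" using P(4) by (rule inj_on_subset) auto
  ultimately have "card ?U = card {1..<p ! i}" by (metis card_image)
  thus ?thesis by (simp add: rank_def)
qed

text \<open>Purely propositional rearrangements that match the two family definitions with \<^const>\<open>parameters\<close>.
  In the second family the block sizes are listed in a different order.\<close>

lemma ex4_cong:
  assumes "\<And>w x y z. (L \<and> P w x y z) = Q w x y z"
  shows "(L \<and> (\<exists>w x y z. P w x y z)) = (\<exists>w x y z. Q w x y z)"
  using assms by blast

lemma ex4_permuted_cong:
  assumes "\<And>w x y z. (L \<and> P w x y z) = Q x w z y"
  shows "(L \<and> (\<exists>w x y z. P w x y z)) = (\<exists>w x y z. Q w x y z)"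
  using assms by blast

lemma conj_rearrange:
  assumes "N \<Longrightarrow> P = P'" "P \<Longrightarrow> L = N"
  shows "(L \<and> A \<and> B \<and> C \<and> D \<and> Z \<and> P) = ((A \<and> B \<and> C \<and> D \<and> Z \<and> N) \<and> P')"
  using assms by blast

lemma conj_rearrange':
  assumes "N \<Longrightarrow> P = P'" "P \<Longrightarrow> L = N" "Z = Z'"
  shows "(L \<and> A \<and> B \<and> C \<and> D \<and> Z \<and> P) = ((C \<and> D \<and> A \<and> B \<and> Z' \<and> N) \<and> P')"
  using assms by blast

lemma family_24153_iff:
  "p \<in> family_24153 n \<longleftrightarrow>
    (\<exists>a c d e. parameters n a c d e \<and> p = map (\<lambda>i. Suc (phi a c d e i)) [0..<n])"
  unfolding family_24153_def mem_Collect_eq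
proof (rule ex4_cong)
  fix a c d e
  show "(length p = n \<and> 1 \<le> a \<and> 1 \<le> d \<and> 2 \<le> c \<and> 2 \<le> e \<and> (a - 1) * (c - 2) + (d - 1) * (e - 2) = 0 \<and>
      p = inflation [2, 4, 1, 5, 3] [iota a, iota 1, iota c, iota d, iota e]) =
    (parameters n a c d e \<and> p = map (\<lambda>i. Suc (phi a c d e i)) [0..<n])"
    unfolding parameters_def inflation_24153_eq
    by (rule conj_rearrange; simp del: upt_Suc)  auto
qed

lemma family_31524_iff:
  "p \<in> family_31524 n \<longleftrightarrow>
    (\<exists>a c d e. parameters n a c d e \<and> p = map (\<lambda>i. Suc (psi a c d e i)) [0..<n])"
  unfolding family_31524_def mem_Collect_eq
proof (rule ex4_permuted_cong)
  fix a b c e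
  show "(length p = n \<and> 2 \<le> a \<and> 2 \<le> c \<and> 1 \<le> b \<and> 1 \<le> e \<and> (a - 2) * (b - 1) + (c - 2) * (e - 1) = 0 \<and>
      p = inflation [3, 1, 5, 2, 4] [iota a, iota b, iota c, iota 1, iota e]) =
    (parameters n b a e c \<and> p = map (\<lambda>i. Suc (psi b a e c i)) [0..<n])"
    unfolding parameters_def inflation_31524_eq
    by (rule conj_rearrange'; simp add: mult.commute del: upt_Suc) auto
qed
lemma phi_permutation:
  "parameters n a c d e \<Longrightarrow> map (\<lambda>i. Suc (phi a c d e i)) [0..<n] \<in> permutations_of_set {1..n}"
  unfolding parameters_def
  by (rule permutation_of_bijection[where h = "psi a c d e"])
    (blast intro: phi_less psi_less phi_psi psi_phi)+

lemma psi_permutation: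
  "parameters n a c d e \<Longrightarrow> map (\<lambda>i. Suc (psi a c d e i)) [0..<n] \<in> permutations_of_set {1..n}"
  unfolding parameters_def
  by (rule permutation_of_bijection[where h = "phi a c d e"])
    (blast intro: phi_less psi_less phi_psi psi_phi)+

lemma permutation_eq_map_iff:
  assumes "p \<in> permutations_of_set {1..n}"
  shows "p = map (\<lambda>i. Suc (g i)) [0..<n] \<longleftrightarrow> (\<forall>i<n. p ! i - 1 = g i)"
proof -
  note P = permutation_facts[OF assms]
  have "p = map (\<lambda>i. Suc (g i)) [0..<n] \<longleftrightarrow> (\<forall>i<n. p ! i = Suc (g i))"
    using P(1) by (auto simp: list_eq_iff_nth_eq)
  also have "\<dots> \<longleftrightarrow> (\<forall>i<n. p ! i - 1 = g i)" using P(5) by fastforce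
  finally show ?thesis .
qed

lemma inflated_iff_family_24153:
  assumes "p \<in> permutations_of_set {1..n}"
  shows "inflated_24153 int (\<lambda>i. int (p ! i)) {..<n} \<longleftrightarrow> p \<in> family_24153 n"
  unfolding inflated_24153_def family_24153_iff permutation_eq_map_iff[OF assms]
  by (simp add: rank_position rank_entry[OF assms] Ball_def)

lemma inflated_iff_family_31524:
  assumes p: "p \<in> permutations_of_set {1..n}"
  shows "inflated_24153 (\<lambda>i. int (p ! i)) int {..<n} \<longleftrightarrow> p \<in> family_31524 n"
proof -
  have "(\<forall>i<n. i = phi a c d e (p ! i - 1)) \<longleftrightarrow> (\<forall>i<n. p ! i - 1 = psi a c d e i)"
    if par: "parameters n a c d e" for a c d e
  proof -
    have n: "n = a + 1 + c + d + e" using par by (simp add: parameters_def)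
    have "p ! i - 1 < n" if "i < n" for i using permutation_facts(5)[OF p that] by linarith
    thus ?thesis unfolding n by (metis phi_psi psi_phi)
  qed
  thus ?thesis
    unfolding inflated_24153_def family_31524_iff permutation_eq_map_iff[OF p]
    by (simp add: rank_position rank_entry[OF p] Ball_def cong: conj_cong)
qed

theorem residuals_eq: "residuals 1 n = family_24153 n \<union> family_31524 n"
proof -
  have "p \<in> permutations_of_set {1..n}" if "p \<in> residuals 1 n \<union> family_24153 n \<union> family_31524 n" for p
    using that phi_permutation psi_permutation
    by (auto simp: residuals_def Av1324_def family_24153_iff family_31524_iff)
  moreover have "p \<in> residuals 1 n \<longleftrightarrow> p \<in> family_24153 n \<union> family_31524 n"
    if p: "p \<in> permutations_of_set {1..n}" for p
  proof -
    let ?Y = "\<lambda>i. int (p ! i)"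
    have inj: "inj_on int {..<n}" "inj_on ?Y {..<n}"
      using permutation_facts(4)[OF p] by (auto simp: inj_on_def)
    have "residual_points int ?Y {..<n} \<longleftrightarrow> inflated_24153 int ?Y {..<n} \<or> inflated_24153 ?Y int {..<n}"
      using residual_points_imp_inflated[OF _ inj] inflated_imp_residual_points[OF _ inj]
        inflated_imp_residual_points[OF _ inj(2,1)] residual_points_swap[of int ?Y] by blast
    thus ?thesis
      by (simp add: residuals_iff[OF p] inflated_iff_family_24153[OF p] inflated_iff_family_31524[OF p])
  qed
  ultimately show ?thesis by blast
qed

section \<open>Inverses and cardinalities\<close>

lemma inverse_perm_eqI:
  assumes p: "p \<in> permutations_of_set {1..n}" and q: "q \<in> permutations_of_set {1..n}"
    and eq: "\<And>i. i < n \<Longrightarrow> p ! (q ! i - 1) = Suc i"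
  shows "inverse_perm p = q"
proof -
  note P = permutation_facts[OF p] and Q = permutation_facts[OF q]
  have inj: "inj (perm_fun p)"
  proof (rule injI)
    fix i j assume ij: "perm_fun p i = perm_fun p j"
    have range: "perm_fun p k \<in> {1..n} \<longleftrightarrow> k \<in> {1..n}" for k
      using P(5)[of "k - 1"] P(1) by (auto simp: perm_fun_def)
    show "i = j"
    proof (cases "i \<in> {1..n}")
      case True
      hence "j \<in> {1..n}" using range ij by metis
      moreover from this True have "p ! (i - 1) = p ! (j - 1)" using ij P(1) by (simp add: perm_fun_def)
      ultimately have "i - 1 = j - 1" using inj_onD[OF P(4), of "i - 1" "j - 1"] True by auto
      thus ?thesis using True \<open>j \<in> {1..n}\<close> by auto
    next
      case False
      moreover from this have "j \<notin> {1..n}" using range ij by metis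
      ultimately have "perm_fun p i = i" "perm_fun p j = j"
        unfolding perm_fun_def P(1) by (simp_all only: if_False)
      thus ?thesis using ij by metis
    qed
  qed
  show ?thesis
  proof (rule nth_equalityI)
    show "length (inverse_perm p) = length q" using P(1) Q(1) by (simp add: inverse_perm_def)
    fix i assume "i < length (inverse_perm p)"
    hence i: "i < n" using P(1) by (simp add: inverse_perm_def del: upt_Suc)
    have "perm_fun p (q ! i) = Suc i" using eq[OF i] Q(5)[OF i] P(1) by (simp add: perm_fun_def)
    hence "inv (perm_fun p) (Suc i) = q ! i" using inj by (metis inv_f_f)
    moreover have "inverse_perm p ! i = inv (perm_fun p) (Suc i)"
      using i P(1) unfolding inverse_perm_def by (simp del: upt_Suc)
    ultimately show "inverse_perm p ! i = q ! i" by simp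
  qed
qed

lemma inverse_perm_families:
  assumes par: "parameters n a c d e"
  shows "inverse_perm (map (\<lambda>i. Suc (phi a c d e i)) [0..<n]) = map (\<lambda>i. Suc (psi a c d e i)) [0..<n]"
    and "inverse_perm (map (\<lambda>i. Suc (psi a c d e i)) [0..<n]) = map (\<lambda>i. Suc (phi a c d e i)) [0..<n]"
proof -
  have n: "n = a + 1 + c + d + e" using par by (simp add: parameters_def)
  show "inverse_perm (map (\<lambda>i. Suc (phi a c d e i)) [0..<n]) = map (\<lambda>i. Suc (psi a c d e i)) [0..<n]"
    by (rule inverse_perm_eqI[OF phi_permutation[OF par] psi_permutation[OF par]])
      (use psi_less[of _ a c d e] phi_psi[of _ a c d e] n in \<open>simp del: upt_Suc\<close>)
  show "inverse_perm (map (\<lambda>i. Suc (psi a c d e i)) [0..<n]) = map (\<lambda>i. Suc (phi a c d e i)) [0..<n]"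
    by (rule inverse_perm_eqI[OF psi_permutation[OF par] phi_permutation[OF par]])
      (use phi_less[of _ a c d e] psi_phi[of _ a c d e] n in \<open>simp del: upt_Suc\<close>)
qed

lemma inverse_perm_image:
  "inverse_perm ` family_24153 n = family_31524 n" "inverse_perm ` family_31524 n = family_24153 n"
proof -
  have "inverse_perm ` family_24153 n \<subseteq> family_31524 n" "inverse_perm ` family_31524 n \<subseteq> family_24153 n"
    using inverse_perm_families unfolding family_24153_iff family_31524_iff
    by (auto simp: family_24153_iff family_31524_iff) blast+
  moreover have "family_31524 n \<subseteq> inverse_perm ` family_24153 n"
  proof
    fix q assume "q \<in> family_31524 n"
    then obtain a c d e where *: "parameters n a c d e" "q = map (\<lambda>i. Suc (psi a c d e i)) [0..<n]"
      by (auto simp: family_31524_iff)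
    hence "map (\<lambda>i. Suc (phi a c d e i)) [0..<n] \<in> family_24153 n" by (auto simp: family_24153_iff)
    thus "q \<in> inverse_perm ` family_24153 n" using inverse_perm_families(1)[OF *(1)] *(2) by (metis imageI)
  qed
  moreover have "family_24153 n \<subseteq> inverse_perm ` family_31524 n"
  proof
    fix q assume "q \<in> family_24153 n"
    then obtain a c d e where *: "parameters n a c d e" "q = map (\<lambda>i. Suc (phi a c d e i)) [0..<n]"
      by (auto simp: family_24153_iff)
    hence "map (\<lambda>i. Suc (psi a c d e i)) [0..<n] \<in> family_31524 n" by (auto simp: family_31524_iff)
    thus "q \<in> inverse_perm ` family_31524 n" using inverse_perm_families(2)[OF *(1)] *(2) by (metis imageI)
  qed
  ultimately show "inverse_perm ` family_24153 n = family_31524 n"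
    "inverse_perm ` family_31524 n = family_24153 n" by blast+
qed

definition parameter_set :: "nat \<Rightarrow> (nat \<times> nat \<times> nat \<times> nat) set" where
  "parameter_set n = {(a, c, d, e). parameters n a c d e}"

lemma parameter_set_small: "n \<le> 6 \<Longrightarrow> parameter_set n = {}" "parameter_set 7 = {(1, 2, 1, 2)}"
  by (auto simp: parameter_set_def parameters_def)

lemma card_parameter_set:
  assumes "8 \<le> n"
  shows "card (parameter_set n) = 4 * (n - 7)"
proof -
  define N where "N = n - 7"
  have N: "n = N + 7" "1 \<le> N" using assms by (auto simp: N_def)
  (* With N = n - 7, the tuples (a - 1, c - 2, d - 1, e - 2) have sum N and at most one nonzero entry in each
     of the pairs first/second and third/fourth.  They are arranged in a cycle of four segments of N tuples. *)
  define T1 where "T1 = (\<lambda>k. (1 + N - k, 2::nat, 1 + k, 2::nat)) ` {..<N}"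
  define T2 where "T2 = (\<lambda>k. (1::nat, 2 + k, 1 + N - k, 2::nat)) ` {..<N}"
  define T3 where "T3 = (\<lambda>k. (1::nat, 2 + N - k, 1::nat, 2 + k)) ` {..<N}"
  define T4 where "T4 = (\<lambda>k. (1 + k, 2::nat, 1::nat, 2 + N - k)) ` {..<N}"
  note T = T1_def T2_def T3_def T4_def
  have "parameter_set n = T1 \<union> T2 \<union> T3 \<union> T4"
  proof
    show "T1 \<union> T2 \<union> T3 \<union> T4 \<subseteq> parameter_set n"
      using N by (auto simp: T parameter_set_def parameters_def)
    show "parameter_set n \<subseteq> T1 \<union> T2 \<union> T3 \<union> T4"
    proof
      fix z assume "z \<in> parameter_set n"
      then obtain a c d e where z: "z = (a, c, d, e)" and par: "parameters n a c d e"
        by (auto simp: parameter_set_def)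
      hence s: "a + c + d + e = N + 6" "1 \<le> a" "1 \<le> d" "2 \<le> c" "2 \<le> e"
        "a = 1 \<or> c = 2" "d = 1 \<or> e = 2"
        using N by (auto simp: parameters_def)
      then consider "c = 2" "e = 2" "a \<noteq> 1" | "a = 1" "e = 2" "d \<noteq> 1" | "a = 1" "d = 1" "c \<noteq> 2"
        | "c = 2" "d = 1" "e \<noteq> 2"
        using N(2) by linarith
      thus "z \<in> T1 \<union> T2 \<union> T3 \<union> T4"
      proof cases
        case 1
        hence "z \<in> T1" unfolding T1_def z using s by (intro image_eqI[of _ _ "d - 1"]) auto
        thus ?thesis by blast
      next
        case 2
        hence "z \<in> T2" unfolding T2_def z using s by (intro image_eqI[of _ _ "c - 2"]) auto
        thus ?thesis by blast
      next
        case 3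
        hence "z \<in> T3" unfolding T3_def z using s by (intro image_eqI[of _ _ "e - 2"]) auto
        thus ?thesis by blast
      next
        case 4
        hence "z \<in> T4" unfolding T4_def z using s by (intro image_eqI[of _ _ "a - 1"]) auto
        thus ?thesis by blast
      qed
    qed
  qed
  also have "card (T1 \<union> T2 \<union> T3 \<union> T4) = N + N + N + N"
    unfolding T by (intro card_Un_eq) (auto simp: card_image inj_on_def)
  finally show ?thesis by (simp add: N_def)
qed

lemma card_family_24153: "card (family_24153 n) = card (parameter_set n)"
proof -
  let ?F = "\<lambda>(a, c, d, e). map (\<lambda>i. Suc (phi a c d e i)) [0..<n]"
  have "family_24153 n = ?F ` parameter_set n"
    by (force simp: family_24153_iff parameter_set_def image_iff)
  moreover have "inj_on ?F (parameter_set n)"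
  proof (rule inj_onI)
    fix z z' assume z: "z \<in> parameter_set n" "z' \<in> parameter_set n" "?F z = ?F z'"
    obtain a c d e a' c' d' e' where zz: "z = (a, c, d, e)" "z' = (a', c', d', e')"
      by (metis prod_cases4)
    have s: "n = a + 1 + c + d + e" "n = a' + 1 + c' + d' + e'" "1 \<le> a" "1 \<le> a'" "1 \<le> c" "1 \<le> c'"
      using z zz by (auto simp: parameter_set_def parameters_def)
    have eq: "phi a c d e i = phi a' c' d' e' i" if "i < n" for i
      using z(3) that unfolding zz by (simp add: list_eq_iff_nth_eq del: upt_Suc)
    have "c = c'" using eq[of 0] s by (simp add: phi_def)
    moreover have "a = a'"
    proof -
      have "phi a c d e (a + 1) = 0" using s by (simp add: phi_def)
      hence "psi a' c' d' e' 0 = a + 1" using eq[of "a + 1"] psi_phi[of "a + 1" a' c' d' e'] s by simp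
      thus ?thesis using s by (simp add: psi_def)
    qed
    moreover from calculation have "e = e'" using eq[of a] s by (simp add: phi_def)
    ultimately show "z = z'" using s zz by simp
  qed
  ultimately show ?thesis by (simp add: card_image)
qed

lemma finite_family [simp]: "finite (family_24153 n)" "finite (family_31524 n)"
proof -
  have "family_24153 n \<union> family_31524 n \<subseteq> permutations_of_set {1..n}"
    using phi_permutation psi_permutation by (auto simp: family_24153_iff family_31524_iff)
  thus "finite (family_24153 n)" "finite (family_31524 n)"
    by (meson finite_permutations_of_set finite_subset le_sup_iff)+
qed

lemma families_disjoint: "family_24153 n \<inter> family_31524 n = {}"
proof (rule ccontr)
  assume "family_24153 n \<inter> family_31524 n \<noteq> {}"
  then obtain a c d e a' c' d' e' where par: "parameters n a c d e" "parameters n a' c' d' e'"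
    and eq: "map (\<lambda>i. Suc (phi a c d e i)) [0..<n] = map (\<lambda>i. Suc (psi a' c' d' e' i)) [0..<n]"
    by (auto simp: family_24153_iff family_31524_iff)
  have s: "n = a + 1 + c + d + e" "n = a' + 1 + c' + d' + e'" "1 \<le> a'" "1 \<le> c" "2 \<le> c'" "1 \<le> e" "1 \<le> d'"
    using par by (auto simp: parameters_def)
  have eq: "phi a c d e i = psi a' c' d' e' i" if "i < n" for i
    using eq that by (simp add: list_eq_iff_nth_eq del: upt_Suc)
  (* the position of the entry 1, counted from 0, is a + 1 in the first family and c' in the second *)
  have "phi a c d e (a + 1) = 0" using s by (simp add: phi_def)
  hence "phi a' c' d' e' 0 = a + 1" using eq[of "a + 1"] phi_psi[of "a + 1" a' c' d' e'] s by simp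
  hence c': "c' = a + 1" using s by (simp add: phi_def)
  have "a + c + e = c' + a'" using eq[of a] s c' by (simp add: phi_def psi_def)
  moreover have "a + c + e = Suc (a' + c' + d')" using eq[of "n - 1"] s by (auto simp: phi_def psi_def)
  ultimately show False by simp
qed

lemma card_residuals: "card (residuals 1 n) = 2 * card (parameter_set n)"
proof -
  have "card (family_31524 n) = card (family_24153 n)"
    using card_image_le[of "family_24153 n" inverse_perm] card_image_le[of "family_31524 n" inverse_perm]
    by (simp add: inverse_perm_image)
  thus ?thesis
    by (simp add: residuals_eq card_Un_disjoint families_disjoint card_family_24153)
qed

theorem theorem1p3:
  shows "(\<forall>n\<ge>8. residuals 1 n = family_24153 n \<union> family_31524 n) \<and>
    (\<forall>n. inverse_perm ` family_24153 n = family_31524 n \<and>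
         inverse_perm ` family_31524 n = family_24153 n) \<and>
    (\<forall>n\<ge>8. card (residuals 1 n) = 8 * (n - 7)) \<and>
    card (residuals 1 7) = 2 \<and>
    (\<forall>n\<le>6. card (residuals 1 n) = 0)"
proof (intro conjI allI impI)
  fix n :: nat
  show "residuals 1 n = family_24153 n \<union> family_31524 n" by (rule residuals_eq)
  show "inverse_perm ` family_24153 n = family_31524 n"
    "inverse_perm ` family_31524 n = family_24153 n" by (fact inverse_perm_image)+
  show "card (residuals 1 n) = 8 * (n - 7)" if "8 \<le> n"
    using card_parameter_set[OF that] by (simp only: card_residuals)
  show "card (residuals 1 7) = 2"
    unfolding card_residuals parameter_set_small(2) by simp
  show "card (residuals 1 n) = 0" if "n \<le> 6"
    unfolding card_residuals parameter_set_small(1)[OF that] by simp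
qed

end
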